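(* Let $G=(V,E)$ be a co-$\{K_4,\text{diamond},\text{paw}\}$-free graph, let $\prec$ be a total order on $V$, and let $H=H^{\prec}_{G}$ be the associated graph, with $\mathcal{R}^{\prec}_{G}=L(H)$. Then the following inequalities give a complete characterization of $P^{Co}_{\prec}(G)$, i.e., identifying the coordinates indexed by $\overline{E}=V(\mathcal{R}^{\prec}_{G})$ with the edges of $H=(V_H,E_H)$, $P^{Co}_{\prec}(G)$ is exactly the set of real vectors $x$ satisfying $$\sum_{v\in N_H(u)}x_{uv}\le 1\quad \forall u\in V_H,$$ $$\sum_{uv\in E_H(S)}x_{uv}\le \frac{|S|-1}{2}\quad \forall S\subseteq V_H,\ |S|\text{ odd},$$ $$x_{uv}\ge 0\quad\forall uv\in E_H.$$
   Context: Graphs are finite and simple. For $G=(V,E)$, $\overline{G}=(V,\overline{E})$ is its complement. Given a total order $\prec$ on $V$ and $u\in V$, let $\bar N^{L}(u)=\{v : uv\in\overline{E},\ v\prec u\}$ and $\bar N^{U}(u)=\{v : uv\in\overline{E},\ u\prec v\}$. Vectors $x\in\mathbb{R}^{|\overline{E}|}$ have one coordinate $x_{uv}$ for each $uv\in\overline{E}$ with $u\prec v$. The representatives constraints are: for every $u\in V$ and every clique $K$ of $G$ with $K\subseteq \bar N^{U}(u)$ (with $K=\emptyset$ allowed), $\sum_{v\in \bar N^{L}(u)} x_{vu}+\sum_{v\in K}x_{uv}\le 1$. $P^{Co}_{\prec}(G)$ is the convex hull of all $x\in\{0,1\}^{|\overline{E}|}$ satisfying all representatives constraints. The graph $\mathcal{R}^{\prec}_{G}$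 has vertex set $\overline{E}$, and two distinct elements of $\overline{E}$ are adjacent if and only if their variables both appear in a common representatives constraint. $L(H)$ denotes the line graph of $H$. A paw is a triangle plus a fourth vertex adjacent to exactly one vertex of the triangle; a diamond is $K_4$ minus one edge. $G$ is co-$\{K_4,\text{diamond},\text{paw}\}$-free if $\overline{G}$ has no induced subgraph isomorphic to $K_4$, the diamond or the paw (equivalently, $\overline{G}$ has no paw as a not necessarily induced subgraph). The complete join $G_1\star G_2$ of graphs on disjoint vertex sets is obtained from their disjoint union by adding all edges between $V_1$ and $V_2$. $\alpha$ denotes the maximum size of a stable set. A co-$\{K_4,\text{diamond},\text{paw}\}$-free graph can be written as $G=G'\star S_1\star\cdots\star S_k$ ($k\ge 0$, $G'$ possibly with no vertices), where $\alpha(G')\le 2$ and each $S_i$ induces a stable set of size 3. Write $S_i=\{u_i,v_i,w_i\}$ with $u_i\prec v_i\prec w_i$, and let $P_i$ be the path on vertices $u_i',v_i,w_i,u_i''$ with edges $u_i'v_i,\ v_iw_i,\ w_iu_i''$ (where $u_i',u_i''$ are new vertices). $H^{\prec}_{G}$ is the disjoint union of $\overline{G'}$ and $P_1,\dots,P_k$. The identification of $\overline{E}$ with $E_H$ that realizes $\mathcal{R}^{\prec}_{G}=L(H)$ is the identity on the edges of $\overline{G'}$, and for each $i$ sends $u_iv_i\mapsto u_i'v_i$, $v_iw_i\mapsto v_iw_i$, $u_iw_i\mapsto w_iu_i''$. $N_H(u)$ is the neighborhood of $u$ in $H$, and $E_H(S)$ is the set of edges of $H$ with both endpoints in $S$.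 *)

theory Defs
  imports "HOL-Analysis.Analysis" "HOL-Analysis.Finite_Function_Topology"
    "HOL-Library.Disjoint_Sets"
begin

section \<open>Finite simple graphs\<close>

datatype 'a graph = Graph (verts: "'a set") (edges: "'a set set")

definition simple_graph :: "'a graph \<Rightarrow> bool" where
  "simple_graph G \<longleftrightarrow> finite (verts G) \<and> (\<forall>e\<in>edges G. e \<subseteq> verts G \<and> card e = 2)"

definition complement :: "'a graph \<Rightarrow> 'a graph" where
  "complement G = Graph (verts G) {e. e \<subseteq> verts G \<and> card e = 2 \<and> e \<notin> edges G}"

definition edges_within :: "'a graph \<Rightarrow> 'a set \<Rightarrow> 'a set set" where
  "edges_within G S = {e \<in> edges G. e \<subseteq> S}"

definition induced_subgraph :: "'a graph \<Rightarrow> 'a set \<Rightarrow> 'a graph" where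
  "induced_subgraph G S = Graph S (edges_within G S)"

definition neighbourhood :: "'a graph \<Rightarrow> 'a \<Rightarrow> 'a set" where
  "neighbourhood G u = {v \<in> verts G. {u, v} \<in> edges G}"

definition is_clique :: "'a graph \<Rightarrow> 'a set \<Rightarrow> bool" where
  "is_clique G K \<longleftrightarrow> K \<subseteq> verts G \<and> (\<forall>u\<in>K. \<forall>v\<in>K. u \<noteq> v \<longrightarrow> {u, v} \<in> edges G)"

definition is_stable :: "'a graph \<Rightarrow> 'a set \<Rightarrow> bool" where
  "is_stable G S \<longleftrightarrow> S \<subseteq> verts G \<and> (\<forall>u\<in>S. \<forall>v\<in>S. {u, v} \<notin> edges G)"

definition stability_number :: "'a graph \<Rightarrow> nat" where
  "stability_number G = Max (card ` {S. is_stable G S})"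

definition graph_iso :: "('a \<Rightarrow> 'b) \<Rightarrow> 'a graph \<Rightarrow> 'b graph \<Rightarrow> bool" where
  "graph_iso f G H \<longleftrightarrow> bij_betw f (verts G) (verts H) \<and>
     (\<forall>u\<in>verts G. \<forall>v\<in>verts G. {u, v} \<in> edges G \<longleftrightarrow> {f u, f v} \<in> edges H)"

definition has_induced :: "'a graph \<Rightarrow> 'b graph \<Rightarrow> bool" where
  "has_induced G F \<longleftrightarrow> (\<exists>S f. S \<subseteq> verts G \<and> graph_iso f F (induced_subgraph G S))"

definition line_graph :: "'a graph \<Rightarrow> 'a set graph" where
  "line_graph G = Graph (edges G)
     {{e, f} | e f. e \<in> edges G \<and> f \<in> edges G \<and> e \<noteq> f \<and> e \<inter> f \<noteq> {}}"

definition K4 :: "nat graph" where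
  "K4 = Graph {0, 1, 2, 3} {{0, 1}, {0, 2}, {0, 3}, {1, 2}, {1, 3}, {2, 3}}"

definition diamond :: "nat graph" where
  "diamond = Graph {0, 1, 2, 3} {{0, 1}, {0, 2}, {0, 3}, {1, 2}, {1, 3}}"

definition paw :: "nat graph" where
  "paw = Graph {0, 1, 2, 3} {{0, 1}, {0, 2}, {0, 3}, {1, 2}}"

definition co_K4_diamond_paw_free :: "'a graph \<Rightarrow> bool" where
  "co_K4_diamond_paw_free G \<longleftrightarrow> \<not> has_induced (complement G) K4 \<and>
     \<not> has_induced (complement G) diamond \<and> \<not> has_induced (complement G) paw"

section \<open>The representatives formulation\<close>

text \<open>The strict order $\prec$ is a relation \<open>r\<close> with \<^prop>\<open>strict_linear_order_on (verts G) r\<close>;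
  \<open>(u, v) \<in> r\<close> means $u \prec v$.\<close>

definition co_nbh_lower :: "('a \<times> 'a) set \<Rightarrow> 'a graph \<Rightarrow> 'a \<Rightarrow> 'a set" where
  "co_nbh_lower r G u = {v \<in> verts G. {u, v} \<in> edges (complement G) \<and> (v, u) \<in> r}"

definition co_nbh_upper :: "('a \<times> 'a) set \<Rightarrow> 'a graph \<Rightarrow> 'a \<Rightarrow> 'a set" where
  "co_nbh_upper r G u = {v \<in> verts G. {u, v} \<in> edges (complement G) \<and> (u, v) \<in> r}"

definition rep_index :: "('a \<times> 'a) set \<Rightarrow> 'a graph \<Rightarrow> ('a \<times> 'a set) set" where
  "rep_index r G = {(u, K). u \<in> verts G \<and> is_clique G K \<and> K \<subseteq> co_nbh_upper r G u}"

text \<open>A vector with one real coordinate per edge of the complement is a finitely supported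
  function whose support lies in that edge set. This makes the library's \<open>convex hull\<close>
  available. Each edge \<open>{u, v}\<close> is a single coordinate, whichever endpoint comes first.\<close>

definition co_edge_vectors :: "'a graph \<Rightarrow> ('a set \<Rightarrow>\<^sub>0 real) set" where
  "co_edge_vectors G = {x. Poly_Mapping.keys x \<subseteq> edges (complement G)}"

definition rep_constraint ::
    "('a \<times> 'a) set \<Rightarrow> 'a graph \<Rightarrow> 'a \<Rightarrow> 'a set \<Rightarrow> ('a set \<Rightarrow>\<^sub>0 real) \<Rightarrow> bool" where
  "rep_constraint r G u K x \<longleftrightarrow>
     (\<Sum>v\<in>co_nbh_lower r G u. Poly_Mapping.lookup x {v, u}) +
     (\<Sum>v\<in>K. Poly_Mapping.lookup x {u, v}) \<le> 1"

definition rep_constraint_vars :: "('a \<times> 'a) set \<Rightarrow> 'a graph \<Rightarrow> 'a \<Rightarrow> 'a set \<Rightarrow> 'a set set" where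
  "rep_constraint_vars r G u K = {{v, u} | v. v \<in> co_nbh_lower r G u} \<union> {{u, v} | v. v \<in> K}"

definition rep_polytope :: "('a \<times> 'a) set \<Rightarrow> 'a graph \<Rightarrow> ('a set \<Rightarrow>\<^sub>0 real) set" where
  "rep_polytope r G = convex hull
     {x \<in> co_edge_vectors G.
        (\<forall>e\<in>edges (complement G). Poly_Mapping.lookup x e \<in> {0, 1}) \<and>
        (\<forall>(u, K)\<in>rep_index r G. rep_constraint r G u K x)}"

definition rep_graph :: "('a \<times> 'a) set \<Rightarrow> 'a graph \<Rightarrow> 'a set graph" where
  "rep_graph r G = Graph (edges (complement G))
     {{e, f} | e f. e \<in> edges (complement G) \<and> f \<in> edges (complement G) \<and> e \<noteq> f \<and>
        (\<exists>(u, K)\<in>rep_index r G.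
           e \<in> rep_constraint_vars r G u K \<and> f \<in> rep_constraint_vars r G u K)}"

section \<open>The join decomposition and the graph \<open>H\<close>\<close>

definition complete_join :: "'a graph \<Rightarrow> 'a graph \<Rightarrow> 'a graph" where
  "complete_join G1 G2 = Graph (verts G1 \<union> verts G2)
     (edges G1 \<union> edges G2 \<union> {{a, b} | a b. a \<in> verts G1 \<and> b \<in> verts G2})"

text \<open>\<open>Ss\<close> lists the vertex sets $S_1, \ldots, S_k$; as stable sets of size 3 they enter the join
  as edgeless graphs.\<close>

definition join_decomposition :: "'a graph \<Rightarrow> 'a graph \<Rightarrow> 'a set list \<Rightarrow> bool" where
  "join_decomposition G G' Ss \<longleftrightarrow>
     simple_graph G' \<and> stability_number G' \<le> 2 \<and>
     (\<forall>S\<in>set Ss. card S = 3 \<and> S \<inter> verts G' = {}) \<and> distinct Ss \<and> disjoint (set Ss) \<and>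
     G = foldl complete_join G' (map (\<lambda>S. Graph S {}) Ss)"

text \<open>\<open>Prime u\<close> and \<open>DPrime u\<close> are the new vertices $u'$ and $u''$ for the smallest vertex \<open>u\<close>
  of a triple.\<close>

datatype 'a hvertex = Orig (base: 'a) | Prime (base: 'a) | DPrime (base: 'a)

definition sorted_triples :: "('a \<times> 'a) set \<Rightarrow> 'a set list \<Rightarrow> ('a \<times> 'a \<times> 'a) set" where
  "sorted_triples r Ss = {(u, v, w). {u, v, w} \<in> set Ss \<and> (u, v) \<in> r \<and> (v, w) \<in> r}"

definition H_graph :: "('a \<times> 'a) set \<Rightarrow> 'a graph \<Rightarrow> 'a set list \<Rightarrow> 'a hvertex graph" where
  "H_graph r G' Ss = Graph
     (Orig ` verts G' \<union>
        (\<Union>(u, v, w)\<in>sorted_triples r Ss. {Prime u, Orig v, Orig w, DPrime u}))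
     ((`) Orig ` edges (complement G') \<union>
        (\<Union>(u, v, w)\<in>sorted_triples r Ss.
           {{Prime u, Orig v}, {Orig v, Orig w}, {Orig w, DPrime u}}))"

text \<open>The identification of the edges of \<open>H\<close> with those of the complement of \<open>G\<close>, read from \<open>H\<close>
  to \<open>G\<close>. Erasing the marks on the endpoints is the identity on the edges of the complement of
  \<open>G'\<close> and maps $u'v$, $vw$, $wu''$ to $uv$, $vw$, $uw$.\<close>

definition H_edge_to_co_edge :: "'a hvertex set \<Rightarrow> 'a set" where
  "H_edge_to_co_edge e = base ` e"

lemma H_edge_to_co_edge_simps [simp]:
  "H_edge_to_co_edge (Orig ` e) = e"
  "H_edge_to_co_edge {Prime u, Orig v} = {u, v}"
  "H_edge_to_co_edge {Orig v, Orig w} = {v, w}"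
  "H_edge_to_co_edge {Orig w, DPrime u} = {u, w}"
  by (auto simp: H_edge_to_co_edge_def image_image)

section \<open>Existence of the join decomposition\<close>

text \<open>Every graph with the forbidden-subgraph property has a join decomposition, so quantifying
  over all decompositions \<open>(G', Ss)\<close> restricts nothing.\<close>

lemma stable_triple_joined:
  assumes G: "simple_graph G" and free: "co_K4_diamond_paw_free G"
    and S: "is_stable G S" "card S = 3" and s: "s \<in> S" and x: "x \<in> verts G" "x \<notin> S"
  shows "{x, s} \<in> edges G"
proof (rule ccontr)
  assume nxs: "{x, s} \<notin> edges G"
  let ?C = "complement G"
  obtain b c where bc: "S = {s, b, c}" "s \<noteq> b" "s \<noteq> c" "b \<noteq> c"
    using S(2) s unfolding card_3_iff by blast
  have ab: "{p, q} \<in> edges ?C \<longleftrightarrow> p \<in> verts G \<and> q \<in> verts G \<and> p \<noteq> q \<and> {p, q} \<notin> edges G" for p q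
    by (auto simp: complement_def card_2_iff doubleton_eq_iff)
  have SV: "s \<in> verts G" "b \<in> verts G" "c \<in> verts G"
    using S(1) bc by (auto simp: is_stable_def)
  have E: "{s, b} \<in> edges ?C" "{s, c} \<in> edges ?C" "{b, c} \<in> edges ?C" "{s, x} \<in> edges ?C"
    using S(1) bc x nxs SV unfolding ab by (auto simp: is_stable_def insert_commute)
  have E': "{b, s} \<in> edges ?C" "{c, s} \<in> edges ?C" "{c, b} \<in> edges ?C" "{x, s} \<in> edges ?C"
    using E by (simp_all add: insert_commute)
  have sw: "{x, p} \<in> edges ?C \<longleftrightarrow> {p, x} \<in> edges ?C" for p by (simp add: insert_commute)
  have nl: "{p} \<notin> edges ?C" for p by (simp add: complement_def)
  define f where "f = (\<lambda>p q y z (n::nat). if n = 0 then p else if n = 1 then q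
                         else if n = 2 then y else (z::'a))"
  have iso: "graph_iso (f p q y z) F (induced_subgraph ?C {p, q, y, z})"
    if "distinct [p, q, y, z]" "verts F = {0, 1, 2, 3}"
      "\<And>i j. i \<in> {0,1,2,3} \<Longrightarrow> j \<in> {0,1,2,3} \<Longrightarrow>
         {i, j} \<in> edges F \<longleftrightarrow> {f p q y z i, f p q y z j} \<in> edges ?C" for p q y z F
    unfolding graph_iso_def
  proof (intro conjI ballI)
    show "bij_betw (f p q y z) (verts F) (verts (induced_subgraph ?C {p, q, y, z}))"
      using that(1) by (auto simp: that(2) bij_betw_def inj_on_def f_def induced_subgraph_def)
  next
    fix i j assume "i \<in> verts F" "j \<in> verts F"
    then show "{i, j} \<in> edges F \<longleftrightarrow>
        {f p q y z i, f p q y z j} \<in> edges (induced_subgraph ?C {p, q, y, z})"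
      using that(3)[of i j]
      by (auto simp: that(2) induced_subgraph_def edges_within_def f_def)
  qed
  have no: "\<not> graph_iso g F (induced_subgraph ?C T)"
    if "F \<in> {K4, diamond, paw}" "T \<subseteq> verts G" for g F T
    using free that unfolding co_K4_diamond_paw_free_def has_induced_def
    by (auto simp: complement_def)
  have d: "distinct [s, b, c, x]" "distinct [s, c, b, x]" using bc x by auto
  have sub: "{s, b, c, x} \<subseteq> verts G" "{s, c, b, x} \<subseteq> verts G" using SV x by auto
  consider "{b, x} \<in> edges ?C" "{c, x} \<in> edges ?C" | "{b, x} \<in> edges ?C" "{c, x} \<notin> edges ?C"
    | "{b, x} \<notin> edges ?C" "{c, x} \<in> edges ?C" | "{b, x} \<notin> edges ?C" "{c, x} \<notin> edges ?C"
    by blast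
  then show False
  proof cases
    case 1
    have "graph_iso (f s b c x) K4 (induced_subgraph ?C {s, b, c, x})"
      by (rule iso) (use d in \<open>auto simp: K4_def f_def doubleton_eq_iff E E' 1 sw nl\<close>)
    then show False using no sub by blast
  next
    case 2
    have "graph_iso (f s b c x) diamond (induced_subgraph ?C {s, b, c, x})"
      by (rule iso) (use d in \<open>auto simp: diamond_def f_def doubleton_eq_iff E E' 2 sw nl\<close>)
    then show False using no sub by blast
  next
    case 3
    have "graph_iso (f s c b x) diamond (induced_subgraph ?C {s, c, b, x})"
      by (rule iso) (use d in \<open>auto simp: diamond_def f_def doubleton_eq_iff E E' 3 sw nl\<close>)
    then show False using no sub by blast
  next
    case 4
    have "graph_iso (f s b c x) paw (induced_subgraph ?C {s, b, c, x})"
      by (rule iso) (use d in \<open>auto simp: paw_def f_def doubleton_eq_iff E E' 4 sw nl\<close>)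
    then show False using no sub by blast
  qed
qed

lemma foldl_join_verts:
  "verts (foldl complete_join G (map (\<lambda>S. Graph S {}) Ss)) = verts G \<union> \<Union>(set Ss)"
  by (induction Ss arbitrary: G) (auto simp: complete_join_def)

lemma foldl_join_edges:
  assumes "distinct Ss"
  shows "edges (foldl complete_join G (map (\<lambda>S. Graph S {}) Ss)) =
     edges G \<union> {{a, b} | a b. a \<in> verts G \<and> b \<in> \<Union>(set Ss)} \<union>
     {{a, b} | a b. \<exists>S\<in>set Ss. \<exists>T\<in>set Ss. S \<noteq> T \<and> a \<in> S \<and> b \<in> T}"
  using assms
proof (induction Ss rule: rev_induct)
  case Nil
  then show ?case by simp
next
  case (snoc S Ss)
  let ?J = "foldl complete_join G (map (\<lambda>S. Graph S {}) Ss)"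
  have "edges (foldl complete_join G (map (\<lambda>S. Graph S {}) (Ss @ [S]))) =
      edges ?J \<union> {{a, b} | a b. a \<in> verts G \<union> \<Union>(set Ss) \<and> b \<in> S}"
    by (simp add: complete_join_def foldl_join_verts)
  also have "edges ?J = edges G \<union> {{a, b} | a b. a \<in> verts G \<and> b \<in> \<Union>(set Ss)} \<union>
     {{a, b} | a b. \<exists>S\<in>set Ss. \<exists>T\<in>set Ss. S \<noteq> T \<and> a \<in> S \<and> b \<in> T}"
    using snoc by simp
  finally have eq: "edges (foldl complete_join G (map (\<lambda>S. Graph S {}) (Ss @ [S]))) =
      edges G \<union> {{a, b} | a b. a \<in> verts G \<and> b \<in> \<Union>(set Ss)} \<union>
     {{a, b} | a b. \<exists>S\<in>set Ss. \<exists>T\<in>set Ss. S \<noteq> T \<and> a \<in> S \<and> b \<in> T} \<union>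
     {{a, b} | a b. a \<in> verts G \<union> \<Union>(set Ss) \<and> b \<in> S}" .
  have "S \<notin> set Ss" using snoc by simp
  then have "{{a, b} | a b. \<exists>X\<in>set (Ss @ [S]). \<exists>T\<in>set (Ss @ [S]). X \<noteq> T \<and> a \<in> X \<and> b \<in> T} =
     {{a, b} | a b. \<exists>S\<in>set Ss. \<exists>T\<in>set Ss. S \<noteq> T \<and> a \<in> S \<and> b \<in> T} \<union>
     {{a, b} | a b. a \<in> \<Union>(set Ss) \<and> b \<in> S}" (is "?L = ?R")
  proof (intro equalityI subsetI)
    fix e assume "e \<in> ?L"
    then obtain a b X T where e: "e = {a, b}" "X \<in> insert S (set Ss)" "T \<in> insert S (set Ss)"
      "X \<noteq> T" "a \<in> X" "b \<in> T" by auto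
    consider "X \<in> set Ss" "T \<in> set Ss" | "X \<in> set Ss" "T = S" | "X = S" "T \<in> set Ss"
      using e by auto
    then show "e \<in> ?R"
    proof cases
      case 3
      then have "e = {b, a}" "b \<in> \<Union>(set Ss)" "a \<in> S" using e by auto
      then show ?thesis by blast
    qed (use e in blast)+
  next
    fix e assume "e \<in> ?R"
    then show "e \<in> ?L" using \<open>S \<notin> set Ss\<close> by fastforce
  qed
  moreover have "{{a, b} | a b. a \<in> verts G \<and> b \<in> \<Union>(set (Ss @ [S]))} =
      {{a, b} | a b. a \<in> verts G \<and> b \<in> \<Union>(set Ss)} \<union> {{a, b} | a b. a \<in> verts G \<and> b \<in> S}"
    by auto
  moreover have "{{a, b} | a b. a \<in> verts G \<union> \<Union>(set Ss) \<and> b \<in> S} =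
      {{a, b} | a b. a \<in> verts G \<and> b \<in> S} \<union> {{a, b} | a b. a \<in> \<Union>(set Ss) \<and> b \<in> S}"
    by blast
  ultimately show ?case unfolding eq by (simp only: Un_ac)
qed

theorem join_decomposition_exists:
  assumes G: "simple_graph G" and free: "co_K4_diamond_paw_free G"
  shows "\<exists>G' Ss. join_decomposition G G' Ss"
proof -
  define T where "T = {S. is_stable G S \<and> card S = 3}"
  have fV: "finite (verts G)" using G by (simp add: simple_graph_def)
  have TV: "S \<subseteq> verts G" if "S \<in> T" for S using that by (auto simp: T_def is_stable_def)
  have "finite T" using TV fV by (meson Pow_iff finite_Pow_iff finite_subset subsetI)
  then obtain Ss where Ss: "set Ss = T" "distinct Ss" using finite_distinct_list by blast
  define W where "W = verts G - \<Union>T"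
  let ?G' = "induced_subgraph G W"
  have join: "{x, s} \<in> edges G" if "S \<in> T" "s \<in> S" "x \<in> verts G" "x \<notin> S" for S s x
    using stable_triple_joined[OF G free] that by (auto simp: T_def)
  have eq: "A = B" if AB: "A \<in> T" "B \<in> T" and s: "s \<in> A" "s \<in> B" for A B s
  proof -
    have "B \<subseteq> A"
    proof
      fix x assume "x \<in> B"
      then have "{x, s} \<notin> edges G" using AB s by (auto simp: T_def is_stable_def)
      then show "x \<in> A" using join[OF AB(1) s(1)] TV[OF AB(2)] \<open>x \<in> B\<close> by blast
    qed
    then show ?thesis using AB TV fV by (metis (mono_tags, lifting) T_def card_subset_eq
      finite_subset mem_Collect_eq)
  qed
  have stab: "stability_number ?G' \<le> 2"
  proof -
    have le: "card S \<le> 2" if "is_stable ?G' S" for S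
    proof (rule ccontr)
      assume "\<not> card S \<le> 2"
      then obtain S' where S': "S' \<subseteq> S" "card S' = 3"
        by (metis not_less_eq_eq obtain_subset_with_card_n numeral_2_eq_2 numeral_3_eq_3)
      have "S' \<subseteq> W" using that S' by (auto simp: is_stable_def induced_subgraph_def)
      moreover have "is_stable G S'"
        unfolding is_stable_def
      proof (intro conjI ballI)
        show "S' \<subseteq> verts G" using \<open>S' \<subseteq> W\<close> by (auto simp: W_def)
        fix u v assume uv: "u \<in> S'" "v \<in> S'"
        then have "{u, v} \<notin> edges ?G'" using that S' by (auto simp: is_stable_def)
        then show "{u, v} \<notin> edges G"
          using uv \<open>S' \<subseteq> W\<close> by (auto simp: induced_subgraph_def edges_within_def)
      qed
      ultimately have "S' \<in> T" "S' \<inter> \<Union>T = {}" using S' by (auto simp: T_def W_def)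
      then show False using S' by (auto simp: card_3_iff)
    qed
    have fin: "finite {S. is_stable ?G' S}"
      by (rule finite_subset[of _ "Pow (verts G)"])
         (auto simp: fV is_stable_def induced_subgraph_def W_def)
    have "is_stable ?G' {}" by (simp add: is_stable_def)
    then show ?thesis unfolding stability_number_def using fin le
      by (subst Max_le_iff) auto
  qed
  have edg: "edges G = edges ?G' \<union> {{a, b} | a b. a \<in> W \<and> b \<in> \<Union>T} \<union>
     {{a, b} | a b. \<exists>A\<in>T. \<exists>B\<in>T. A \<noteq> B \<and> a \<in> A \<and> b \<in> B}" (is "_ = ?R")
  proof (intro equalityI subsetI)
    fix e assume e: "e \<in> edges G"
    then obtain a b where ab: "e = {a, b}" "a \<in> verts G" "b \<in> verts G"
      using G by (auto simp: simple_graph_def card_2_iff)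
    consider "a \<in> W" "b \<in> W" | "a \<in> W" "b \<in> \<Union>T" | "a \<in> \<Union>T" "b \<in> W" | "a \<in> \<Union>T" "b \<in> \<Union>T"
      using ab by (auto simp: W_def)
    then show "e \<in> ?R"
    proof cases
      case 1 then show ?thesis using e ab by (auto simp: induced_subgraph_def edges_within_def)
    next
      case 2 then show ?thesis using ab by blast
    next
      case 3
      then have "e = {b, a}" using ab by auto
      then show ?thesis using 3 by blast
    next
      case 4
      then obtain A B where "A \<in> T" "B \<in> T" "a \<in> A" "b \<in> B" by blast
      moreover have "A \<noteq> B" using calculation e ab by (auto simp: T_def is_stable_def)
      ultimately show ?thesis using ab by blast
    qed
  next
    fix e assume "e \<in> ?R"
    then consider "e \<in> edges ?G'" | a b where "e = {a, b}" "a \<in> W" "b \<in> \<Union>T"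
      | a b A B where "e = {a, b}" "A \<in> T" "B \<in> T" "A \<noteq> B" "a \<in> A" "b \<in> B"
      by blast
    then show "e \<in> edges G"
    proof cases
      case 1 then show ?thesis by (auto simp: induced_subgraph_def edges_within_def)
    next
      case 2 then show ?thesis using join by (auto simp: W_def)
    next
      case 3
      then have "a \<notin> B" using eq by blast
      then show ?thesis using 3 join[of B b a] TV by blast
    qed
  qed
  have "G = foldl complete_join ?G' (map (\<lambda>S. Graph S {}) Ss)"
  proof (rule graph.expand, intro conjI)
    show "verts G = verts (foldl complete_join ?G' (map (\<lambda>S. Graph S {}) Ss))"
      using TV by (auto simp: foldl_join_verts Ss induced_subgraph_def W_def)
    show "edges G = edges (foldl complete_join ?G' (map (\<lambda>S. Graph S {}) Ss))"
      unfolding foldl_join_edges[OF Ss(2)] edg Ss(1) by (simp add: induced_subgraph_def)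
  qed
  moreover have "simple_graph ?G'"
    using G by (auto simp: simple_graph_def induced_subgraph_def edges_within_def W_def)
  moreover have "\<forall>S\<in>set Ss. card S = 3 \<and> S \<inter> verts ?G' = {}"
    by (auto simp: Ss T_def W_def induced_subgraph_def)
  moreover have "disjoint (set Ss)" using eq by (auto simp: Ss disjoint_def)
  ultimately have "join_decomposition G ?G' Ss"
    using stab Ss(2) unfolding join_decomposition_def by blast
  then show ?thesis by blast
qed

end

theory Submission
  imports Defs
begin

text \<open>The 0/1 points of the polytope are the matchings of \<open>H\<close>, so the asserted description is
  Edmonds' matching polytope theorem for \<open>H\<close>.

  Two distinct edges of the complement of \<open>G\<close> occur in a common representatives constraint exactly if
  they are \<open>{t, p}\<close> and \<open>{t, q}\<close> where one of \<open>p\<close>, \<open>q\<close> precedes \<open>t\<close> or \<open>{p, q}\<close> is an edge of \<open>G\<close>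
  (\<open>conflict_iff\<close>). The complement of \<open>G'\<close> has no triangles, so there every two edges that meet
  conflict. A triple \<open>u \<prec> v \<prec> w\<close> is a triangle component of the complement; of its three pairs of
  edges only \<open>uv\<close>, \<open>uw\<close> does not conflict, because \<open>u\<close> precedes \<open>v\<close> and \<open>w\<close>, which are not adjacent
  in \<open>G\<close>. Splitting \<open>u\<close> into \<open>u'\<close> and \<open>u''\<close> removes just this incidence. So conflict
  in \<open>G\<close> is incidence in \<open>H\<close> (\<open>meet_imp_conflict\<close>, \<open>conflict_imp_meet\<close>). This is the
  isomorphism, and since a representatives constraint on a 0/1 vector says that at
  most one of its variables is 1, it also identifies the 0/1 points with matchings.

  For Edmonds' theorem, a point \<open>x\<close> outside the hull of the matchings would be separated from it by
  weights \<open>w\<close> whose value at \<open>x\<close> exceeds their value at every matching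
  (\<open>mem_convex_hull_if_weights\<close>). If \<open>x\<close> satisfies Edmonds' inequalities, no such \<open>w\<close> exists
  (\<open>weight_le_max_matching\<close>): edges of nonpositive weight can be deleted, and otherwise some
  degree or odd-set inequality with edge set \<open>A\<close> holds with equality for all matchings of maximum
  weight (\<open>tight_inequality\<close>). If that inequality reads \<open>x(A) \<le> k\<close>, lowering \<open>w\<close> by
  \<open>\<epsilon>\<close> on \<open>A\<close> lowers the maximum by \<open>\<epsilon> * k\<close> and the value at \<open>x\<close> by at most that much, so it
  suffices to treat the lowered weights. The largest possible \<open>\<epsilon>\<close> produces an edge of weight 0 or
  an additional maximum matching, and the process ends.

  The tight inequality is found as in Lovasz's proof. If no vertex is covered by all maximum-weight
  matchings, call two vertices equivalent if they are equal or no maximum-weight matching misses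
  both. Exchanging two matchings along a component of their union shows transitivity
  (\<open>max_matching_move_exposed\<close>), and the ends of an edge of positive weight are equivalent; so
  a class is a union of components in which every maximum-weight matching misses
  exactly one vertex, and its odd-set inequality is tight.\<close>

section \<open>Maximum-weight matchings\<close>

definition matching :: "'v set set \<Rightarrow> 'v set set \<Rightarrow> bool" where
  "matching E M \<longleftrightarrow> M \<subseteq> E \<and> disjoint M"

definition max_matching :: "'v set set \<Rightarrow> ('v set \<Rightarrow> real) \<Rightarrow> 'v set set \<Rightarrow> bool" where
  "max_matching E w M \<longleftrightarrow> matching E M \<and> (\<forall>N. matching E N \<longrightarrow> sum w N \<le> sum w M)"

lemma matching_subset_edges: "matching E M \<Longrightarrow> E \<subseteq> F \<Longrightarrow> matching F M"
  by (auto simp: matching_def)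

lemma matchingI:
  "M \<subseteq> E \<Longrightarrow> (\<And>e f v. e \<in> M \<Longrightarrow> f \<in> M \<Longrightarrow> v \<in> e \<Longrightarrow> v \<in> f \<Longrightarrow> e = f) \<Longrightarrow> matching E M"
  unfolding matching_def disjoint_def by (meson disjoint_iff)

lemma matching_unique_edge:
  "matching E M \<Longrightarrow> e \<in> M \<Longrightarrow> f \<in> M \<Longrightarrow> v \<in> e \<Longrightarrow> v \<in> f \<Longrightarrow> e = f"
  unfolding matching_def disjoint_def by (meson disjoint_iff)

lemma matching_subset: "matching E M \<Longrightarrow> N \<subseteq> M \<Longrightarrow> matching E N"
  unfolding matching_def disjoint_def by (meson subset_iff)

lemma max_matching_exists:
  assumes "finite E"
  obtains M where "max_matching E w M"
proof -
  have fin: "finite {M. matching E M}"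
    by (rule finite_subset[of _ "Pow E"]) (use assms in \<open>auto simp: matching_def\<close>)
  have ne: "{} \<in> {M. matching E M}" by (simp add: matching_def disjoint_def)
  obtain M where "M \<in> {M. matching E M}" "Max (sum w ` {M. matching E M}) = sum w M"
    using Max_in[of "sum w ` {M. matching E M}"] fin ne by blast
  then have "max_matching E w M"
    using Max_ge[OF finite_imageI[OF fin], of _ "sum w"] unfolding max_matching_def by force
  then show thesis by (rule that)
qed

lemma card_covered_by_matching:
  assumes "\<forall>e\<in>E. card e = 2" "matching E M"
  shows "card (\<Union>M) = 2 * card M"
proof -
  have M: "M \<subseteq> E" "disjoint M" using assms(2) by (auto simp: matching_def)
  have c2: "card e = 2" if "e \<in> M" for e using M(1) assms(1) that by auto
  have "card (\<Union>M) = sum card M"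
    using M(2) by (intro card_Union_disjoint) (auto simp: c2 intro: card_ge_0_finite)
  then show ?thesis using c2 by simp
qed

text \<open>A matching inside \<open>C\<close> has at most half as many edges as \<open>C\<close> has vertices. The exchange
  argument below needs what is gained from the vertices \<open>X\<close> that the matching misses.\<close>

lemma card_matching_inside:
  assumes "\<forall>e\<in>E. card e = 2" "matching E M" "finite C" "X \<subseteq> C" "X \<inter> \<Union>M = {}"
  shows "2 * card {e \<in> M. e \<subseteq> C} + card X \<le> card C"
proof -
  have m: "matching E {e \<in> M. e \<subseteq> C}" by (rule matching_subset[OF assms(2)]) auto
  have "card (\<Union>{e \<in> M. e \<subseteq> C}) + card X = card (\<Union>{e \<in> M. e \<subseteq> C} \<union> X)"
    using assms by (subst card_Un_disjoint) (auto intro: finite_subset)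
  also have "\<dots> \<le> card C" using assms by (intro card_mono) auto
  finally show ?thesis using card_covered_by_matching[OF assms(1) m] by simp
qed

text \<open>Such a \<open>C\<close> stands in for the connected component of \<open>t\<close>; closure and the spanning-tree bound
  on the number of edges are all that the exchange argument uses of it. Both come at once from a
  largest set that still satisfies the bound: an edge leaving it would add one vertex and at least
  one edge.\<close>

lemma closed_set_with_many_edges:
  assumes "finite F" "\<forall>e\<in>F. card e = 2"
  obtains C where "t \<in> C" "finite C" "\<forall>e\<in>F. e \<inter> C = {} \<or> e \<subseteq> C"
    "card C \<le> card {e \<in> F. e \<subseteq> C} + 1"
proof -
  define \<W> where "\<W> = {W. W \<subseteq> insert t (\<Union>F) \<and> t \<in> W \<and> card W \<le> card {e \<in> F. e \<subseteq> W} + 1}"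
  have "finite e" if "e \<in> F" for e using assms that by (intro card_ge_0_finite) simp
  then have finU: "finite (insert t (\<Union>F))" using assms(1) by auto
  then have "finite \<W>" unfolding \<W>_def by (auto intro: finite_subset[OF _ iffD2[OF finite_Pow_iff]])
  then have fin: "finite (card ` \<W>)" by simp
  have "{t} \<in> \<W>" by (simp add: \<W>_def)
  then have "Max (card ` \<W>) \<in> card ` \<W>" using fin by (intro Max_in) auto
  then obtain C where C: "C \<in> \<W>" and "Max (card ` \<W>) = card C" by auto
  then have mx: "card W \<le> card C" if "W \<in> \<W>" for W using Max_ge[OF fin, of "card W"] that by auto
  have finC: "finite C" using C finU by (auto simp: \<W>_def intro: finite_subset)
  have "e \<inter> C = {} \<or> e \<subseteq> C" if e: "e \<in> F" for e
  proof (rule ccontr)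
    assume "\<not> ?thesis"
    then obtain a b where ab: "a \<in> e" "a \<in> C" "b \<in> e" "b \<notin> C" by auto
    have "card e = 2" using e assms by auto
    then have eab: "e = {a, b}" using ab by (auto simp: card_2_iff)
    have "insert e {e \<in> F. e \<subseteq> C} \<subseteq> {e \<in> F. e \<subseteq> insert b C}" using e eab ab by auto
    then have "card (insert e {e \<in> F. e \<subseteq> C}) \<le> card {e \<in> F. e \<subseteq> insert b C}"
      using assms(1) by (intro card_mono) auto
    moreover have "e \<notin> {e \<in> F. e \<subseteq> C}" using ab by auto
    ultimately have "card {e \<in> F. e \<subseteq> C} + 1 \<le> card {e \<in> F. e \<subseteq> insert b C}"
      using assms(1) by simp
    then have "insert b C \<in> \<W>" using C e ab finC by (auto simp: \<W>_def)
    then show False using mx[of "insert b C"] finC ab by simp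
  qed
  then show thesis using that[of C] C finC by (auto simp: \<W>_def)
qed

text \<open>Exchanging the parts inside \<open>C\<close> turns \<open>M\<close> and \<open>N\<close> into two matchings with the same total
  weight, so neither of them can have lost weight.\<close>

lemma max_matching_swap:
  assumes "finite E" "\<forall>e\<in>E. e \<noteq> {}"
    and M: "max_matching E w M" and N: "max_matching E w N"
    and C: "\<forall>e\<in>M \<union> N. e \<inter> C = {} \<or> e \<subseteq> C"
  shows "max_matching E w ({e \<in> M. e \<inter> C = {}} \<union> {e \<in> N. e \<subseteq> C})"
proof -
  have swap: "matching E ({e \<in> A. e \<inter> C = {}} \<union> {e \<in> B. e \<subseteq> C})"
    if "matching E A" "matching E B" for A B
  proof (rule matchingI)
    show "{e \<in> A. e \<inter> C = {}} \<union> {e \<in> B. e \<subseteq> C} \<subseteq> E" using that by (auto simp: matching_def)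
    fix e f v
    assume "e \<in> {e \<in> A. e \<inter> C = {}} \<union> {e \<in> B. e \<subseteq> C}" "f \<in> {e \<in> A. e \<inter> C = {}} \<union> {e \<in> B. e \<subseteq> C}"
      and v: "v \<in> e" "v \<in> f"
    then have "e \<in> A \<and> f \<in> A \<or> e \<in> B \<and> f \<in> B" by auto
    then show "e = f" using v that matching_unique_edge by metis
  qed
  have split: "sum w {e \<in> A. e \<inter> C = {}} + sum w {e \<in> B. e \<subseteq> C} =
      sum w ({e \<in> A. e \<inter> C = {}} \<union> {e \<in> B. e \<subseteq> C})" if "A \<subseteq> E" "B \<subseteq> E" for A B
  proof (rule sum.union_disjoint[symmetric])
    show "{e \<in> A. e \<inter> C = {}} \<inter> {e \<in> B. e \<subseteq> C} = {}"
      using that assms(2) by (auto simp: Int_absorb2)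
  qed (use that assms(1) in \<open>auto intro: finite_subset\<close>)
  have sub: "M \<subseteq> E" "N \<subseteq> E" using M N by (auto simp: max_matching_def matching_def)
  have same: "{e \<in> M. e \<inter> C = {}} \<union> {e \<in> M. e \<subseteq> C} = M"
    "{e \<in> N. e \<inter> C = {}} \<union> {e \<in> N. e \<subseteq> C} = N" using C by auto
  let ?M = "{e \<in> M. e \<inter> C = {}} \<union> {e \<in> N. e \<subseteq> C}"
  let ?N = "{e \<in> N. e \<inter> C = {}} \<union> {e \<in> M. e \<subseteq> C}"
  have total: "sum w ?M + sum w ?N = sum w M + sum w N"
    using split[of M N] split[of N M] split[of M M] split[of N N] sub same by simp
  have m: "matching E ?M" "matching E ?N" using M N swap by (auto simp: max_matching_def)
  have "sum w ?N \<le> sum w N" using N m by (auto simp: max_matching_def)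
  then have "sum w M \<le> sum w ?M" using total by simp
  then show ?thesis using m(1) M unfolding max_matching_def by (meson order_trans)
qed

text \<open>This is the transitivity of "no maximum matching misses both": if some maximum matching misses
  \<open>u\<close> and \<open>v\<close>, then for every \<open>t\<close> that can be missed at all, some maximum matching misses \<open>t\<close>
  together with \<open>u\<close> or \<open>v\<close>. It arises by exchanging \<open>M\<close> and \<open>N\<close> on the component \<open>C\<close> of \<open>t\<close> in their
  union. The component is too small in edges to contain both \<open>u\<close> and \<open>v\<close>, since \<open>M\<close> would then have
  at most \<open>(|C| - 2) / 2\<close> edges in it and \<open>N\<close> at most \<open>(|C| - 1) / 2\<close>, fewer than the \<open>|C| - 1\<close>
  needed to connect it.\<close>

lemma max_matching_move_exposed:
  assumes "finite E" "\<forall>e\<in>E. card e = 2"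
    and M: "max_matching E w M" "u \<notin> \<Union>M" "v \<notin> \<Union>M" "u \<noteq> v"
    and N: "max_matching E w N" "t \<notin> \<Union>N"
  obtains L where "max_matching E w L" "t \<notin> \<Union>L" "u \<notin> \<Union>L \<or> v \<notin> \<Union>L"
proof -
  have m: "matching E M" "matching E N" using M N by (auto simp: max_matching_def)
  have fin: "finite (M \<union> N)" and c2: "\<forall>e\<in>M \<union> N. card e = 2"
    using m assms(1,2) by (auto simp: matching_def intro: finite_subset)
  obtain C where C: "t \<in> C" "finite C" "\<forall>e\<in>M \<union> N. e \<inter> C = {} \<or> e \<subseteq> C"
    "card C \<le> card {e \<in> M \<union> N. e \<subseteq> C} + 1"
    using closed_set_with_many_edges[OF fin c2, of t] by blast
  have "u \<notin> C \<or> v \<notin> C"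
  proof (rule ccontr)
    assume "\<not> ?thesis"
    then have "2 * card {e \<in> M. e \<subseteq> C} + card {u, v} \<le> card C"
      using M(2,3) C(2) by (intro card_matching_inside[OF assms(2) m(1)]) auto
    moreover have "2 * card {e \<in> N. e \<subseteq> C} + card {t} \<le> card C"
      using N(2) C(1,2) by (intro card_matching_inside[OF assms(2) m(2)]) auto
    moreover have "{e \<in> M \<union> N. e \<subseteq> C} = {e \<in> M. e \<subseteq> C} \<union> {e \<in> N. e \<subseteq> C}" by auto
    then have "card {e \<in> M \<union> N. e \<subseteq> C} \<le> card {e \<in> M. e \<subseteq> C} + card {e \<in> N. e \<subseteq> C}"
      by (simp only: card_Un_le)
    ultimately show False using C(4) M(4) by simp
  qed
  moreover have "max_matching E w ({e \<in> M. e \<inter> C = {}} \<union> {e \<in> N. e \<subseteq> C})"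
    using assms(1,2) by (intro max_matching_swap[OF _ _ M(1) N(1) C(3)]) auto
  moreover have "t \<notin> \<Union>({e \<in> M. e \<inter> C = {}} \<union> {e \<in> N. e \<subseteq> C})" using C(1) N(2) by auto
  moreover have "z \<notin> \<Union>({e \<in> M. e \<inter> C = {}} \<union> {e \<in> N. e \<subseteq> C})" if "z \<notin> C" "z \<notin> \<Union>M" for z
    using that by auto
  ultimately show thesis using that M(2,3) by meson
qed

text \<open>\<open>U\<close> is the class of a vertex \<open>a\<close> under the equivalence "equal, or missed together by no
  maximum matching", which is transitive once every vertex is missed by some maximum matching. A
  maximum matching cannot miss both ends of an edge, since adding that edge, which has positive
  weight, would improve it. Hence \<open>U\<close> is closed under edges, and a maximum matching misses at
  most one vertex of \<open>U\<close>. Some maximum matching misses \<open>a\<close>, so \<open>|U|\<close> is odd, and by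
  parity every maximum matching misses exactly one vertex of \<open>U\<close>.\<close>

lemma tight_inequality:
  assumes "finite E" "\<forall>e\<in>E. card e = 2" "E \<noteq> {}" and pos: "\<forall>e\<in>E. 0 < w e"
  shows "(\<exists>U\<subseteq>\<Union>E. odd (card U) \<and> {e \<in> E. e \<subseteq> U} \<noteq> {} \<and>
       (\<forall>M. max_matching E w M \<longrightarrow> 2 * card {e \<in> M. e \<subseteq> U} + 1 = card U)) \<or>
    (\<exists>v\<in>\<Union>E. \<forall>M. max_matching E w M \<longrightarrow> v \<in> \<Union>M)"
proof (rule disjCI)
  assume "\<not> (\<exists>v\<in>\<Union>E. \<forall>M. max_matching E w M \<longrightarrow> v \<in> \<Union>M)"
  then have missed: "\<exists>M. max_matching E w M \<and> v \<notin> \<Union>M" if "v \<in> \<Union>E" for v using that by blast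
  obtain a b where ab: "{a, b} \<in> E" "a \<noteq> b"
    using assms(2,3) by (metis card_2_iff ex_in_conv)
  have "finite e" if "e \<in> E" for e using assms(2) that by (intro card_ge_0_finite) simp
  then have finV: "finite (\<Union>E)" using assms(1) by auto
  define U where "U = {v \<in> \<Union>E. v = a \<or> \<not> (\<exists>M. max_matching E w M \<and> a \<notin> \<Union>M \<and> v \<notin> \<Union>M)}"
  have "U \<subseteq> \<Union>E" unfolding U_def by blast
  then have U: "U \<subseteq> \<Union>E" "finite U" using finV by (auto intro: finite_subset)
  have aE: "a \<in> \<Union>E" using ab by auto
  then have aU: "a \<in> U" by (simp add: U_def)
  have edge_covered: "p \<in> \<Union>M \<or> q \<in> \<Union>M" if "max_matching E w M" "{p, q} \<in> E" for M p q
  proof (rule ccontr)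
    assume n: "\<not> ?thesis"
    have "matching E (insert {p, q} M)"
      using that n unfolding max_matching_def matching_def disjoint_def by auto
    then have "sum w (insert {p, q} M) \<le> sum w M" using that by (auto simp: max_matching_def)
    moreover have "finite M" "{p, q} \<notin> M"
      using that n assms(1) by (auto simp: max_matching_def matching_def intro: finite_subset)
    ultimately show False using pos that by force
  qed
  have one: "p = q" if M: "max_matching E w M" "p \<notin> \<Union>M" "q \<notin> \<Union>M" and pq: "p \<in> U" "q \<in> U"
    for M p q
  proof (rule ccontr)
    assume "p \<noteq> q"
    have miss_a: "z \<in> \<Union>L" if "z \<in> U" "z \<noteq> a" "max_matching E w L" "a \<notin> \<Union>L" for z L
      using that unfolding U_def by blast
    have "a \<in> \<Union>M" using miss_a[OF _ _ M(1)] M(2,3) pq \<open>p \<noteq> q\<close> by metis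
    obtain N where "max_matching E w N" "a \<notin> \<Union>N" using missed[OF aE] by blast
    then obtain L where "max_matching E w L" "a \<notin> \<Union>L" "p \<notin> \<Union>L \<or> q \<notin> \<Union>L"
      using max_matching_move_exposed[OF assms(1,2) M \<open>p \<noteq> q\<close>] by blast
    then show False using miss_a pq M(2,3) \<open>a \<in> \<Union>M\<close> by metis
  qed
  have "q \<in> U" if pq: "{p, q} \<in> E" "p \<in> U" for p q
  proof (rule ccontr)
    assume "q \<notin> U"
    then obtain M where M: "max_matching E w M" "a \<notin> \<Union>M" "q \<notin> \<Union>M" "q \<noteq> a"
      using pq by (auto simp: U_def)
    have "p \<in> \<Union>E" using pq(2) U(1) by blast
    then obtain N where "max_matching E w N" "p \<notin> \<Union>N" using missed by blast
    then obtain L where L: "max_matching E w L" "p \<notin> \<Union>L" "a \<notin> \<Union>L \<or> q \<notin> \<Union>L"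
      using max_matching_move_exposed[OF assms(1,2) M(1-3)] M(4) by metis
    moreover have "q \<in> \<Union>L" using edge_covered[OF L(1) pq(1)] L(2) by blast
    ultimately have "p = a" using pq(2) unfolding U_def by blast
    then show False using edge_covered[OF M(1) pq(1)] M by blast
  qed
  then have closed: "e \<subseteq> U" if "e \<in> E" "e \<inter> U \<noteq> {}" for e
    using that assms(2) by (fastforce simp: card_2_iff insert_commute)
  have cov: "2 * card {e \<in> M. e \<subseteq> U} = card (U \<inter> \<Union>M)" if M: "max_matching E w M" for M
  proof -
    have m: "matching E {e \<in> M. e \<subseteq> U}"
      using M by (auto simp: max_matching_def intro: matching_subset)
    have "U \<inter> \<Union>M = \<Union>{e \<in> M. e \<subseteq> U}"
      using closed M by (auto simp: max_matching_def matching_def)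
    then show ?thesis using card_covered_by_matching[OF assms(2) m] by simp
  qed
  have split: "card U = card (U \<inter> \<Union>M) + card (U - \<Union>M)" for M :: "'a set set"
    using U(2)
    by (metis Diff_disjoint Int_Diff_Un card_Un_disjoint finite_Diff finite_Int Int_Diff_disjoint)
  have le1: "card (U - \<Union>M) \<le> 1" if "max_matching E w M" for M
    using one[OF that] U(2) card_le_Suc0_iff_eq[of "U - \<Union>M"] by simp
  have oddU: "odd (card U)"
  proof -
    obtain M where M: "max_matching E w M" "a \<notin> \<Union>M" using missed[OF aE] by blast
    then have "card (U - \<Union>M) = 1"
      using le1[OF M(1)] U(2) aU
      by (metis Diff_iff One_nat_def card_gt_0_iff empty_iff finite_Diff le_antisym Suc_leI)
    then show ?thesis using split[of M] cov[OF M(1)] by presburger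
  qed
  have "2 * card {e \<in> M. e \<subseteq> U} + 1 = card U" if "max_matching E w M" for M
    using oddU split[of M] cov[OF that] le1[OF that] by presburger
  moreover have "{a, b} \<subseteq> U" using closed[OF ab(1)] aU by simp
  ultimately show "\<exists>U\<subseteq>\<Union>E. odd (card U) \<and> {e \<in> E. e \<subseteq> U} \<noteq> {} \<and>
       (\<forall>M. max_matching E w M \<longrightarrow> 2 * card {e \<in> M. e \<subseteq> U} + 1 = card U)"
    using U(1) oddU ab(1) by (intro exI[of _ U]) blast
qed

section \<open>Edmonds' inequalities bound the weight of a point\<close>

definition edmonds_inequalities :: "'v set \<Rightarrow> 'v set set \<Rightarrow> ('v set \<Rightarrow> real) \<Rightarrow> bool" where
  "edmonds_inequalities V E x \<longleftrightarrow> (\<forall>v\<in>V. (\<Sum>e | e \<in> E \<and> v \<in> e. x e) \<le> 1) \<and>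
     (\<forall>S. S \<subseteq> V \<and> odd (card S) \<longrightarrow> (\<Sum>e | e \<in> E \<and> e \<subseteq> S. x e) \<le> (real (card S) - 1) / 2) \<and>
     (\<forall>e\<in>E. 0 \<le> x e)"

lemma edmonds_inequalities_subset:
  assumes "edmonds_inequalities V E x" "finite E" "F \<subseteq> E"
  shows "edmonds_inequalities V F x"
proof -
  have le: "(\<Sum>e | e \<in> F \<and> P e. x e) \<le> (\<Sum>e | e \<in> E \<and> P e. x e)" for P
    using assms by (intro sum_mono2) (auto simp: edmonds_inequalities_def)
  show ?thesis
    using assms le[of "\<lambda>e. _ \<in> e"] le[of "\<lambda>e. e \<subseteq> _"] unfolding edmonds_inequalities_def
    by (meson order_trans subsetD)
qed

text \<open>The common form of both alternatives: an inequality \<open>x(A) \<le> k\<close> that all maximum-weight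
  matchings satisfy with equality.\<close>

lemma tight_edge_set:
  assumes "finite E" "\<forall>e\<in>E. e \<subseteq> V \<and> card e = 2" "E \<noteq> {}" "\<forall>e\<in>E. 0 < w e"
    and x: "edmonds_inequalities V E x"
  obtains A k where "A \<subseteq> E" "A \<noteq> {}" "sum x A \<le> real k"
    "\<forall>M. max_matching E w M \<longrightarrow> card (M \<inter> A) = k"
proof -
  obtain M where M: "max_matching E w M" by (rule max_matching_exists[OF assms(1)])
  have V: "\<Union>E \<subseteq> V" using assms by auto
  have c2: "\<forall>e\<in>E. card e = 2" using assms by auto
  show thesis
    using tight_inequality[OF assms(1) c2 assms(3,4)]
  proof (elim disjE bexE exE conjE)
    fix v assume v: "v \<in> \<Union>E" "\<forall>M. max_matching E w M \<longrightarrow> v \<in> \<Union>M"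
    have "card (M \<inter> {e \<in> E. v \<in> e}) = 1" if M: "max_matching E w M" for M
    proof -
      obtain e where e: "e \<in> M" "v \<in> e" using v M by auto
      have "matching E M" using M by (simp add: max_matching_def)
      then have "f = e" if "f \<in> M" "v \<in> f" for f
        using e that matching_unique_edge by metis
      moreover have "M \<subseteq> E" using \<open>matching E M\<close> by (simp add: matching_def)
      ultimately have "M \<inter> {e \<in> E. v \<in> e} = {e}"
        using e by blast
      then show ?thesis by simp
    qed
    then show thesis
      using v V x by (intro that[of "{e \<in> E. v \<in> e}" 1]) (auto simp: edmonds_inequalities_def)
  next
    fix U assume U: "U \<subseteq> \<Union>E" "odd (card U)" "{e \<in> E. e \<subseteq> U} \<noteq> {}"
       "\<forall>M. max_matching E w M \<longrightarrow> 2 * card {e \<in> M. e \<subseteq> U} + 1 = card U"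
    have eq: "M \<inter> {e \<in> E. e \<subseteq> U} = {e \<in> M. e \<subseteq> U}" if "max_matching E w M" for M
      using that by (auto simp: max_matching_def matching_def)
    have k: "2 * card {e \<in> M. e \<subseteq> U} + 1 = card U" using U M by blast
    have "sum x {e \<in> E. e \<subseteq> U} \<le> (real (card U) - 1) / 2"
      using x U V unfolding edmonds_inequalities_def by (meson order_trans)
    also have "\<dots> = real (card {e \<in> M. e \<subseteq> U})" using k by (simp flip: k)
    finally have le: "sum x {e \<in> E. e \<subseteq> U} \<le> real (card {e \<in> M. e \<subseteq> U})" .
    have "card (N \<inter> {e \<in> E. e \<subseteq> U}) = card {e \<in> M. e \<subseteq> U}" if "max_matching E w N" for N
    proof -
      have "2 * card {e \<in> N. e \<subseteq> U} + 1 = card U" using U(4) that by blast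
      then show ?thesis using k unfolding eq[OF that] by linarith
    qed
    then show thesis using that[OF _ U(3) le] by blast
  qed
qed

definition suboptimal :: "'v set set \<Rightarrow> ('v set \<Rightarrow> real) \<Rightarrow> 'v set set set" where
  "suboptimal E w = {M. matching E M \<and> \<not> max_matching E w M}"

lemma suboptimal_mono: "F \<subseteq> E \<Longrightarrow> suboptimal F w \<subseteq> suboptimal E w"
  unfolding suboptimal_def max_matching_def by (auto intro: matching_subset_edges)

lemma finite_suboptimal: "finite E \<Longrightarrow> finite (suboptimal E w)"
  by (rule finite_subset[of _ "Pow E"]) (auto simp: suboptimal_def matching_def)

text \<open>A primal-dual argument without an explicit dual solution: each lowering of \<open>w\<close> by \<open>\<epsilon>\<close> on the
  edge set of a tight inequality would add \<open>\<epsilon>\<close> to the dual variable of that inequality. The measure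
  drops because lowering creates no new suboptimal matchings and either allows an edge to be
  deleted or makes one more matching optimal.\<close>

lemma weight_le_max_matching:
  assumes "finite E" "\<forall>e\<in>E. e \<subseteq> V \<and> card e = 2" "edmonds_inequalities V E x"
  shows "\<exists>M. matching E M \<and> (\<Sum>e\<in>E. w e * x e) \<le> sum w M"
  using assms
proof (induction "card E + card (suboptimal E w)" arbitrary: E w rule: less_induct)
  case less
  note fin = less.prems(1) and edge = less.prems(2) and x = less.prems(3)
  have x0: "0 \<le> x e" if "e \<in> E" for e using x that by (simp add: edmonds_inequalities_def)
  \<comment> \<open>An edge of nonpositive weight contributes nothing positive at \<open>x\<close> and may be deleted. This is
    needed for the given weights and for the lowered ones.\<close>
  have delete: "\<exists>M. matching E M \<and> (\<Sum>e\<in>E. w' e * x e) \<le> sum w' M"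
    if e: "e \<in> E" "w' e \<le> 0" and sub: "suboptimal E w' \<subseteq> suboptimal E w" for e w'
  proof -
    have "suboptimal (E - {e}) w' \<subseteq> suboptimal E w" using suboptimal_mono[of "E - {e}" E w'] sub by blast
    then have "card (suboptimal (E - {e}) w') \<le> card (suboptimal E w)"
      using fin by (intro card_mono finite_suboptimal)
    moreover have "card (E - {e}) < card E" using e fin by (meson card_Diff1_less)
    ultimately have "\<exists>M. matching (E - {e}) M \<and> (\<Sum>e\<in>E - {e}. w' e * x e) \<le> sum w' M"
      using fin edge edmonds_inequalities_subset[OF x fin, of "E - {e}"]
      by (intro less.hyps) auto
    moreover have "(\<Sum>e\<in>E. w' e * x e) = w' e * x e + (\<Sum>e\<in>E - {e}. w' e * x e)"
      using e fin by (simp add: sum.remove)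
    moreover have "w' e * x e \<le> 0" using e x0[of e] by (simp add: mult_nonpos_nonneg)
    ultimately show ?thesis using matching_subset_edges[of "E - {e}" _ E] by fastforce
  qed
  consider "E = {}" | e where "e \<in> E" "w e \<le> 0" | "E \<noteq> {}" "\<forall>e\<in>E. 0 < w e" by fastforce
  then show ?case
  proof cases
    case 1
    then show ?thesis by (auto simp: matching_def disjoint_def)
  next
    case 2
    then show ?thesis using delete by blast
  next
    case 3
    obtain A k where A: "A \<subseteq> E" "A \<noteq> {}" "sum x A \<le> real k"
      and tight: "\<And>M. max_matching E w M \<Longrightarrow> card (M \<inter> A) = k"
      using tight_edge_set[OF fin edge 3 x] by metis
    have finA: "finite A" using A fin finite_subset by blast
    obtain M where M: "max_matching E w M" by (rule max_matching_exists[OF fin])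
    \<comment> \<open>Lowering the weight by \<open>\<epsilon>\<close> on \<open>A\<close> costs a maximum matching \<open>\<epsilon> * k\<close>. Only matchings with fewer
      than \<open>k\<close> edges in \<open>A\<close> catch up, and \<open>N\<close> does so when \<open>\<epsilon>\<close> reaches \<open>slope N\<close>.\<close>
    define B where "B = {N. matching E N \<and> card (N \<inter> A) < k}"
    define slope where "slope N = (sum w M - sum w N) / (real k - real (card (N \<inter> A)))" for N
    have finB: "finite B"
      by (rule finite_subset[of _ "Pow E"]) (use fin in \<open>auto simp: B_def matching_def\<close>)
    define \<epsilon> where "\<epsilon> = Min (w ` A \<union> slope ` B)"
    have \<epsilon>_in: "\<epsilon> \<in> w ` A \<union> slope ` B" unfolding \<epsilon>_def using finA finB A by (intro Min_in) auto
    have \<epsilon>_le: "\<epsilon> \<le> y" if "y \<in> w ` A \<union> slope ` B" for y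
      unfolding \<epsilon>_def using finA finB that by (intro Min_le) auto
    have slope_pos: "0 < slope N" if "N \<in> B" for N
    proof -
      have "\<not> max_matching E w N" using that tight[of N] by (auto simp: B_def)
      then have "sum w N < sum w M"
        using that M unfolding B_def max_matching_def
        by (metis (mono_tags) mem_Collect_eq not_le order_trans)
      then show ?thesis using that by (simp add: slope_def B_def)
    qed
    have \<epsilon>_pos: "0 < \<epsilon>" using \<epsilon>_in slope_pos 3 A by auto
    define w' where "w' = (\<lambda>e. w e - (if e \<in> A then \<epsilon> else 0))"
    have w': "sum w' N = sum w N - \<epsilon> * card (N \<inter> A)" if "matching E N" for N
    proof -
      have "finite N" using that fin by (auto simp: matching_def intro: finite_subset)
      then show ?thesis by (simp add: w'_def sum_subtractf sum.If_cases)
    qed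
    have w'_le: "sum w' N \<le> sum w M - \<epsilon> * k" if N: "matching E N" for N
    proof (cases "card (N \<inter> A) < k")
      case True
      then have "\<epsilon> \<le> slope N" using \<epsilon>_le N by (auto simp: B_def)
      then have "\<epsilon> * (real k - real (card (N \<inter> A))) \<le> sum w M - sum w N"
        using True by (simp add: slope_def pos_le_divide_eq)
      then show ?thesis by (simp add: w'[OF N] algebra_simps)
    next
      case False
      then have "\<epsilon> * k \<le> \<epsilon> * card (N \<inter> A)" using \<epsilon>_pos by simp
      moreover have "sum w N \<le> sum w M" using M N by (simp add: max_matching_def)
      ultimately show ?thesis by (simp add: w'[OF N])
    qed
    have w'_max: "sum w' N = sum w M - \<epsilon> * k" if N: "max_matching E w N" for N
    proof -
      have "sum w N = sum w M" using M N unfolding max_matching_def by (meson order_antisym)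
      moreover have "matching E N" using N by (simp add: max_matching_def)
      ultimately show ?thesis using tight[OF N] w' by simp
    qed
    have sub: "suboptimal E w' \<subseteq> suboptimal E w"
      using w'_le w'_max by (auto simp: suboptimal_def max_matching_def[of E w'])
    have "\<exists>M. matching E M \<and> (\<Sum>e\<in>E. w' e * x e) \<le> sum w' M"
    proof (cases "\<epsilon> \<in> w ` A")
      case True
      then obtain e where "e \<in> A" "w' e = 0" by (auto simp: w'_def)
      then show ?thesis using delete[of e w'] sub A by auto
    next
      case False
      then obtain N where N: "N \<in> B" "\<epsilon> = slope N" using \<epsilon>_in by auto
      then have mN: "matching E N" by (simp add: B_def)
      have "\<epsilon> * (real k - real (card (N \<inter> A))) = sum w M - sum w N"
        using N by (simp add: slope_def B_def)
      then have "sum w' N = sum w M - \<epsilon> * k" by (simp add: w'[OF mN] algebra_simps)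
      then have "N \<notin> suboptimal E w'" using w'_le mN by (simp add: suboptimal_def max_matching_def)
      moreover have "N \<in> suboptimal E w" using N tight[of N] by (auto simp: suboptimal_def B_def)
      ultimately have "suboptimal E w' \<subset> suboptimal E w" using sub by blast
      then have "card (suboptimal E w') < card (suboptimal E w)"
        using fin by (intro psubset_card_mono finite_suboptimal)
      then show ?thesis using fin edge x by (intro less.hyps) auto
    qed
    then have "(\<Sum>e\<in>E. w' e * x e) \<le> sum w M - \<epsilon> * k" using w'_le by fastforce
    moreover have "(\<Sum>e\<in>E. w e * x e) = (\<Sum>e\<in>E. w' e * x e) + \<epsilon> * sum x A"
    proof -
      have "(\<Sum>e\<in>E. w e * x e) = (\<Sum>e\<in>E. w' e * x e + (if e \<in> A then \<epsilon> * x e else 0))"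
        by (intro sum.cong) (auto simp: w'_def algebra_simps)
      also have "\<dots> = (\<Sum>e\<in>E. w' e * x e) + \<epsilon> * sum x A"
        using fin A by (simp add: sum.distrib sum.If_cases Int_absorb1 sum_distrib_left)
      finally show ?thesis .
    qed
    moreover have "\<epsilon> * sum x A \<le> \<epsilon> * k" using A \<epsilon>_pos by simp
    ultimately have "(\<Sum>e\<in>E. w e * x e) \<le> sum w M" by linarith
    then show ?thesis using M by (auto simp: max_matching_def)
  qed
qed

section \<open>Separation from the convex hull of finitely many vectors\<close>

lemma lookup_scaleR: "Poly_Mapping.lookup (c *\<^sub>R x) i = c * Poly_Mapping.lookup x i"
  for x :: "'i \<Rightarrow>\<^sub>0 real"
proof -
  have "finite {i. c * Poly_Mapping.lookup x i \<noteq> 0}"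
    by (rule finite_subset[OF _ finite_lookup[of x]]) auto
  then show ?thesis by (simp add: scaleR_poly_mapping_def)
qed

lemma bounded_linear_lookup: "bounded_linear (\<lambda>x :: 'i \<Rightarrow>\<^sub>0 real. Poly_Mapping.lookup x i)"
proof (rule bounded_linear_intro[where K = 1])
  fix x :: "'i \<Rightarrow>\<^sub>0 real"
  have "\<bar>Poly_Mapping.lookup x i\<bar> \<le> (\<Sum>n\<in>Poly_Mapping.keys x. \<bar>Poly_Mapping.lookup x n\<bar>)"
    by (cases "i \<in> Poly_Mapping.keys x")
       (auto simp: in_keys_iff intro: member_le_sum sum_nonneg)
  then show "norm (Poly_Mapping.lookup x i) \<le> norm x * 1"
    by (simp add: norm_poly_mapping_def dist_poly_mapping_def)
qed (simp_all add: lookup_add lookup_scaleR)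

lemma convex_keys_subset: "convex {x :: 'i \<Rightarrow>\<^sub>0 real. Poly_Mapping.keys x \<subseteq> C}"
proof (rule convexI)
  fix x y :: "'i \<Rightarrow>\<^sub>0 real" and u v :: real
  assume "x \<in> {x. Poly_Mapping.keys x \<subseteq> C}" "y \<in> {x. Poly_Mapping.keys x \<subseteq> C}"
  then show "u *\<^sub>R x + v *\<^sub>R y \<in> {x. Poly_Mapping.keys x \<subseteq> C}"
    by (auto simp: in_keys_iff lookup_add lookup_scaleR subset_iff)
       (metis add.right_neutral mult_zero_right)
qed

text \<open>The separating weights are \<open>x - y\<close>, where \<open>y\<close> is the point of the hull closest to \<open>x\<close> in the
  Euclidean distance on the coordinates \<open>C\<close>. The \<open>b\<close> that dominates \<open>x\<close> for these weights
  shows that moving from \<open>y\<close> towards \<open>b\<close> would come closer to \<open>x\<close>, unless \<open>y = x\<close>.\<close>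

lemma mem_convex_hull_if_weights:
  fixes B :: "('i \<Rightarrow>\<^sub>0 real) set"
  assumes "finite B" "finite C" and keys: "\<And>y. y \<in> insert x B \<Longrightarrow> Poly_Mapping.keys y \<subseteq> C"
    and dominated: "\<And>c :: 'i \<Rightarrow> real. \<exists>b\<in>B. (\<Sum>i\<in>C. c i * Poly_Mapping.lookup x i) \<le>
      (\<Sum>i\<in>C. c i * Poly_Mapping.lookup b i)"
  shows "x \<in> convex hull B"
proof -
  let ?l = Poly_Mapping.lookup
  define q where "q y = (\<Sum>i\<in>C. (?l x i - ?l y i)\<^sup>2)" for y
  have "continuous_on (convex hull B) q"
    unfolding q_def using linear_continuous_on[OF bounded_linear_lookup]
    by (intro continuous_intros)
  moreover have "convex hull B \<noteq> {}" using dominated[of "\<lambda>_. 0"] by auto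
  ultimately obtain y where y: "y \<in> convex hull B" "\<And>z. z \<in> convex hull B \<Longrightarrow> q y \<le> q z"
    using continuous_attains_inf[OF finite_imp_compact_convex_hull[OF assms(1)]] by blast
  obtain b where b: "b \<in> B" and
    bx: "(\<Sum>i\<in>C. (?l x i - ?l y i) * ?l x i) \<le> (\<Sum>i\<in>C. (?l x i - ?l y i) * ?l b i)"
    using dominated[of "\<lambda>i. ?l x i - ?l y i"] by blast
  define D where "D = (\<Sum>i\<in>C. (?l b i - ?l y i)\<^sup>2)"
  define I where "I = (\<Sum>i\<in>C. (?l x i - ?l y i) * (?l b i - ?l y i))"
  have D0: "0 \<le> D" and q0: "0 \<le> q y" by (auto simp: D_def q_def intro: sum_nonneg)
  have "q y = (\<Sum>i\<in>C. (?l x i - ?l y i) * ?l x i) - (\<Sum>i\<in>C. (?l x i - ?l y i) * ?l y i)"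
    by (simp add: q_def power2_eq_square right_diff_distrib sum_subtractf)
  moreover have "I = (\<Sum>i\<in>C. (?l x i - ?l y i) * ?l b i) - (\<Sum>i\<in>C. (?l x i - ?l y i) * ?l y i)"
    by (simp add: I_def right_diff_distrib sum_subtractf)
  ultimately have I: "q y \<le> I" using bx by simp
  have move: "q ((1 - t) *\<^sub>R y + t *\<^sub>R b) = q y - 2 * t * I + t\<^sup>2 * D" for t
  proof -
    have "q ((1 - t) *\<^sub>R y + t *\<^sub>R b) = (\<Sum>i\<in>C. (?l x i - ?l y i)\<^sup>2
        - 2 * t * ((?l x i - ?l y i) * (?l b i - ?l y i)) + t\<^sup>2 * (?l b i - ?l y i)\<^sup>2)"
      unfolding q_def by (intro sum.cong refl) (simp add: lookup_add lookup_scaleR, algebra)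
    then show ?thesis
      by (simp add: q_def I_def D_def sum.distrib sum_subtractf sum_distrib_left)
  qed
  have "q y = 0"
  proof (rule ccontr)
    assume "q y \<noteq> 0"
    then have pos: "0 < q y" using q0 by simp
    \<comment> \<open>A step short enough that the quadratic term \<open>t\<^sup>2 * D\<close> stays below the linear gain.\<close>
    define t where "t = q y / (q y + D)"
    have t: "0 < t" "t \<le> 1" using pos D0 by (auto simp: t_def)
    have tD: "t * D < q y" using pos D0 by (simp add: t_def divide_simps)
    have "(1 - t) *\<^sub>R y + t *\<^sub>R b \<in> convex hull B"
      using t y(1) b by (intro convexD[OF convex_convex_hull]) (auto intro: hull_inc)
    then have "0 \<le> t * (t * D - 2 * I)" using y(2) move[of t]
      by (force simp: algebra_simps power2_eq_square)
    then have "2 * I \<le> t * D" using t by (simp add: zero_le_mult_iff)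
    then show False using tD I pos by linarith
  qed
  then have on_C: "?l x i = ?l y i" if "i \<in> C" for i
    using that assms(2) by (simp add: q_def sum_nonneg_eq_0_iff)
  have "convex hull B \<subseteq> {y. Poly_Mapping.keys y \<subseteq> C}"
    using keys by (intro hull_minimal convex_keys_subset) auto
  then have "x = y"
    using on_C y(1) keys[of x] by (intro poly_mapping_eqI)
      (metis in_keys_iff insertI1 mem_Collect_eq subsetD)
  then show ?thesis using y(1) by simp
qed

section \<open>The matching polytope\<close>

definition incidence_vector :: "'i set \<Rightarrow> 'i \<Rightarrow>\<^sub>0 real" where
  "incidence_vector S = Abs_poly_mapping (\<lambda>i. if i \<in> S then 1 else 0)"

lemma lookup_incidence_vector:
  "finite S \<Longrightarrow> Poly_Mapping.lookup (incidence_vector S) i = (if i \<in> S then 1 else 0)"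
  by (simp add: incidence_vector_def)

lemma zero_one_vector_eq_incidence_vector:
  assumes "\<forall>i\<in>C. Poly_Mapping.lookup x i \<in> {0, 1}" "Poly_Mapping.keys x \<subseteq> C"
  shows "x = incidence_vector (Poly_Mapping.keys x)"
  using assms by (intro poly_mapping_eqI) (auto simp: lookup_incidence_vector in_keys_iff)

lemma sum_01_eq_card:
  fixes x :: "'b \<Rightarrow> real"
  assumes "finite A" "\<forall>a\<in>A. x a \<in> {0, 1}"
  shows "sum x A = real (card {a \<in> A. x a = 1})"
proof -
  have "sum x A = (\<Sum>a\<in>A. if x a = 1 then 1 else 0)" using assms by (intro sum.cong) auto
  then show ?thesis using assms(1) by (simp add: sum.If_cases Int_def)
qed

lemma sum_01_le_1_iff:
  fixes x :: "'b \<Rightarrow> real"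
  assumes "finite A" "\<forall>a\<in>A. x a \<in> {0, 1}"
  shows "sum x A \<le> 1 \<longleftrightarrow> (\<forall>a\<in>A. \<forall>b\<in>A. x a = 1 \<longrightarrow> x b = 1 \<longrightarrow> a = b)"
proof -
  have "sum x A \<le> 1 \<longleftrightarrow> card {a \<in> A. x a = 1} \<le> Suc 0"
    using sum_01_eq_card[OF assms] by simp
  also have "\<dots> \<longleftrightarrow> (\<forall>a\<in>A. \<forall>b\<in>A. x a = 1 \<longrightarrow> x b = 1 \<longrightarrow> a = b)"
    using assms(1) by (subst card_le_Suc0_iff_eq) auto
  finally show ?thesis .
qed

lemma edmonds_inequalities_convex_combination:
  assumes x: "edmonds_inequalities V E x" and y: "edmonds_inequalities V E y"
    and uv: "0 \<le> u" "0 \<le> v" "u + v = 1"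
  shows "edmonds_inequalities V E (\<lambda>e. u * x e + v * y e)"
proof -
  have "(\<Sum>e\<in>A. u * x e + v * y e) \<le> b" if "sum x A \<le> b" "sum y A \<le> b" for A b
    using convex_bound_le[OF that uv] by (simp add: sum.distrib sum_distrib_left)
  then show ?thesis
    using x y uv by (simp add: edmonds_inequalities_def del: le_divide_eq_numeral1)
qed

lemma edmonds_inequalities_matching:
  assumes "finite E" "\<forall>e\<in>E. card e = 2" and x01: "\<forall>e\<in>E. x e \<in> {0, 1}"
    and m: "matching E {e \<in> E. x e = 1}"
  shows "edmonds_inequalities V E x"
  unfolding edmonds_inequalities_def
proof (intro conjI ballI allI impI)
  fix v assume "v \<in> V"
  have "\<forall>e\<in>{e \<in> E. v \<in> e}. \<forall>f\<in>{e \<in> E. v \<in> e}. x e = 1 \<longrightarrow> x f = 1 \<longrightarrow> e = f"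
  proof (intro ballI impI)
    fix e f assume "e \<in> {e \<in> E. v \<in> e}" "f \<in> {e \<in> E. v \<in> e}" "x e = 1" "x f = 1"
    then show "e = f" by (intro matching_unique_edge[OF m, of e f v]) simp_all
  qed
  moreover have "finite {e \<in> E. v \<in> e}" "\<forall>e\<in>{e \<in> E. v \<in> e}. x e \<in> {0, 1}"
    using assms(1) x01 by simp_all
  ultimately show "(\<Sum>e | e \<in> E \<and> v \<in> e. x e) \<le> 1" by (simp only: sum_01_le_1_iff)
next
  fix S assume S: "S \<subseteq> V \<and> odd (card S)"
  then have "finite S" using card.infinite by fastforce
  then have "2 * card {e \<in> {e \<in> E. x e = 1}. e \<subseteq> S} \<le> card S"
    using card_matching_inside[OF assms(2) m, of S "{}"] by simp
  moreover have "{e \<in> {e \<in> E. x e = 1}. e \<subseteq> S} = {e \<in> {e \<in> E. e \<subseteq> S}. x e = 1}" by auto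
  ultimately have "2 * card {e \<in> {e \<in> E. e \<subseteq> S}. x e = 1} \<le> card S" by (simp only:)
  then have "2 * card {e \<in> {e \<in> E. e \<subseteq> S}. x e = 1} + 1 \<le> card S"
    using conjunct2[OF S] by presburger
  then have "2 * real (card {e \<in> {e \<in> E. e \<subseteq> S}. x e = 1}) + 1 \<le> real (card S)" by linarith
  moreover have "(\<Sum>e | e \<in> E \<and> e \<subseteq> S. x e) = real (card {e \<in> {e \<in> E. e \<subseteq> S}. x e = 1})"
    using assms(1) x01 by (intro sum_01_eq_card) simp_all
  ultimately show "(\<Sum>e | e \<in> E \<and> e \<subseteq> S. x e) \<le> (real (card S) - 1) / 2" by simp
next
  fix e assume "e \<in> E"
  then show "0 \<le> x e" using x01 by force
qed

text \<open>Coordinates are indexed through an injection \<open>\<pi>\<close> of the edges, since the edges of \<open>H\<close> will be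
  named by edges of another graph.\<close>

theorem edmonds_matching_polytope:
  fixes \<pi> :: "'v set \<Rightarrow> 'i"
  assumes fin: "finite E" and edge: "\<forall>e\<in>E. e \<subseteq> V \<and> card e = 2" and inj: "inj_on \<pi> E"
  shows "convex hull {x :: 'i \<Rightarrow>\<^sub>0 real. Poly_Mapping.keys x \<subseteq> \<pi> ` E \<and>
      (\<forall>i\<in>\<pi> ` E. Poly_Mapping.lookup x i \<in> {0, 1}) \<and>
      matching E {e \<in> E. Poly_Mapping.lookup x (\<pi> e) = 1}} =
    {x. Poly_Mapping.keys x \<subseteq> \<pi> ` E \<and>
      edmonds_inequalities V E (\<lambda>e. Poly_Mapping.lookup x (\<pi> e))}" (is "convex hull ?B = ?P")
proof (intro equalityI subsetI)
  have "convex ?P"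
  proof (rule convexI)
    fix x y :: "'i \<Rightarrow>\<^sub>0 real" and u v :: real
    assume "x \<in> ?P" "y \<in> ?P" "0 \<le> u" "0 \<le> v" "u + v = 1"
    then show "u *\<^sub>R x + v *\<^sub>R y \<in> ?P"
      using convexD[OF convex_keys_subset, of x "\<pi> ` E" y u v]
      by (simp add: lookup_add lookup_scaleR edmonds_inequalities_convex_combination)
  qed
  moreover have "?B \<subseteq> ?P" using fin edge by (auto intro!: edmonds_inequalities_matching)
  ultimately show "x \<in> ?P" if "x \<in> convex hull ?B" for x using that hull_minimal[of ?B ?P] by blast
next
  fix x assume x: "x \<in> ?P"
  have "?B \<subseteq> incidence_vector ` Pow (\<pi> ` E)" using zero_one_vector_eq_incidence_vector by blast
  then have finB: "finite ?B" by (rule finite_subset) (simp add: fin)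
  show "x \<in> convex hull ?B"
  proof (rule mem_convex_hull_if_weights[OF finB, of "\<pi> ` E"])
    show "finite (\<pi> ` E)" using fin by simp
    show "Poly_Mapping.keys y \<subseteq> \<pi> ` E" if "y \<in> insert x ?B" for y using that x by auto
    fix c :: "'i \<Rightarrow> real"
    obtain M where M: "matching E M" and
      le: "(\<Sum>e\<in>E. c (\<pi> e) * Poly_Mapping.lookup x (\<pi> e)) \<le> (\<Sum>e\<in>M. c (\<pi> e))"
      using weight_le_max_matching[OF fin edge, of "\<lambda>e. Poly_Mapping.lookup x (\<pi> e)"
          "\<lambda>e. c (\<pi> e)"] x
      by auto
    have sub: "M \<subseteq> E" using M by (simp add: matching_def)
    then have finM: "finite (\<pi> ` M)" using fin by (auto intro: finite_subset)
    define b where "b = incidence_vector (\<pi> ` M)"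
    have b: "Poly_Mapping.lookup b (\<pi> e) = (if e \<in> M then 1 else 0)" if "e \<in> E" for e
      unfolding b_def lookup_incidence_vector[OF finM] using that sub inj
      by (simp add: inj_on_image_mem_iff)
    have "Poly_Mapping.keys b \<subseteq> \<pi> ` E"
      using sub by (auto simp: b_def in_keys_iff lookup_incidence_vector[OF finM] intro!: imageI
          split: if_splits)
    moreover have "{e \<in> E. Poly_Mapping.lookup b (\<pi> e) = 1} = M"
      using b sub by (auto split: if_splits)
    ultimately have bB: "b \<in> ?B" using b M by auto
    have sum_b: "(\<Sum>i\<in>\<pi> ` E. c i * Poly_Mapping.lookup b i) = (\<Sum>e\<in>M. c (\<pi> e))"
    proof -
      have "(\<Sum>i\<in>\<pi> ` E. c i * Poly_Mapping.lookup b i) = (\<Sum>e\<in>E. if e \<in> M then c (\<pi> e) else 0)"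
        using inj b by (auto simp: sum.reindex intro!: sum.cong)
      then show ?thesis using sub fin by (simp add: sum.If_cases Int_absorb1)
    qed
    have sum_x: "(\<Sum>i\<in>\<pi> ` E. c i * Poly_Mapping.lookup x i) =
        (\<Sum>e\<in>E. c (\<pi> e) * Poly_Mapping.lookup x (\<pi> e))"
      using inj by (simp add: sum.reindex)
    show "\<exists>b\<in>?B. (\<Sum>i\<in>\<pi> ` E. c i * Poly_Mapping.lookup x i)
        \<le> (\<Sum>i\<in>\<pi> ` E. c i * Poly_Mapping.lookup b i)"
      using le bB unfolding sum_x by (intro bexI[of _ b]) (simp_all only: sum_b)
  qed
qed

section \<open>The edges of the graph \<open>H\<close>\<close>

locale join_decomposed_graph =
  fixes G G' :: "'a graph" and Ss :: "'a set list" and r :: "('a \<times> 'a) set"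
  assumes simple: "simple_graph G"
    and order: "strict_linear_order_on (verts G) r"
    and decomposition: "join_decomposition G G' Ss"
begin

abbreviation co_edges :: "'a set set" where "co_edges \<equiv> edges (complement G)"

abbreviation H :: "'a hvertex graph" where "H \<equiv> H_graph r G' Ss"

abbreviation T :: "('a \<times> 'a \<times> 'a) set" where "T \<equiv> sorted_triples r Ss"

lemma simple': "simple_graph G'"
  and card_part: "S \<in> set Ss \<Longrightarrow> card S = 3"
  and part_disjoint: "S \<in> set Ss \<Longrightarrow> z \<in> S \<Longrightarrow> z \<notin> verts G'"
  and parts_eq: "S \<in> set Ss \<Longrightarrow> R \<in> set Ss \<Longrightarrow> z \<in> S \<Longrightarrow> z \<in> R \<Longrightarrow> S = R"
  and verts_G: "verts G = verts G' \<union> \<Union>(set Ss)"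
  and edges_G: "edges G = edges G' \<union> {{a, b} | a b. a \<in> verts G' \<and> b \<in> \<Union>(set Ss)} \<union>
     {{a, b} | a b. \<exists>S\<in>set Ss. \<exists>R\<in>set Ss. S \<noteq> R \<and> a \<in> S \<and> b \<in> R}"
proof -
  note d = decomposition[unfolded join_decomposition_def]
  have G: "G = foldl complete_join G' (map (\<lambda>S. Graph S {}) Ss)" using d by blast
  show "simple_graph G'" using d by blast
  show "card S = 3" if "S \<in> set Ss" using d that by blast
  show "z \<notin> verts G'" if "S \<in> set Ss" "z \<in> S" using d that by blast
  show "S = R" if "S \<in> set Ss" "R \<in> set Ss" "z \<in> S" "z \<in> R"
    using d that unfolding disjoint_def by blast
  show "verts G = verts G' \<union> \<Union>(set Ss)" unfolding G by (rule foldl_join_verts)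
  have "distinct Ss" using d by blast
  then show "edges G = edges G' \<union> {{a, b} | a b. a \<in> verts G' \<and> b \<in> \<Union>(set Ss)} \<union>
     {{a, b} | a b. \<exists>S\<in>set Ss. \<exists>R\<in>set Ss. S \<noteq> R \<and> a \<in> S \<and> b \<in> R}"
    unfolding G by (rule foldl_join_edges)
qed

lemma order_trans: "(p, q) \<in> r \<Longrightarrow> (q, t) \<in> r \<Longrightarrow> (p, t) \<in> r"
  and order_irrefl: "(p, p) \<notin> r"
  and order_total: "p \<in> verts G \<Longrightarrow> q \<in> verts G \<Longrightarrow> p \<noteq> q \<Longrightarrow> (p, q) \<in> r \<or> (q, p) \<in> r"
  using order unfolding strict_linear_order_on_def trans_def irrefl_def total_on_def by blast+

lemma order_asym: "(p, q) \<in> r \<Longrightarrow> (q, p) \<notin> r"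
  using order_trans order_irrefl by blast

lemma finite_verts: "finite (verts G)" "finite (verts G')"
  using simple simple' by (auto simp: simple_graph_def)

lemma edge_in_verts': "{p, q} \<in> edges G' \<Longrightarrow> p \<in> verts G'"
  using simple' by (auto simp: simple_graph_def)

lemma co_edge_iff:
  "{p, q} \<in> co_edges \<longleftrightarrow> p \<in> verts G \<and> q \<in> verts G \<and> p \<noteq> q \<and> {p, q} \<notin> edges G"
  by (auto simp: complement_def card_2_iff doubleton_eq_iff)

lemma co_edge'_iff: "{p, q} \<in> edges (complement G') \<longleftrightarrow>
    p \<in> verts G' \<and> q \<in> verts G' \<and> p \<noteq> q \<and> {p, q} \<notin> edges G'"
  by (auto simp: complement_def card_2_iff doubleton_eq_iff)

lemma co_edge_doubleton:
  assumes "e \<in> co_edges" "t \<in> e"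
  obtains p where "e = {t, p}"
  using assms by (auto simp: complement_def card_2_iff insert_commute)

lemma edge_in_G'_iff: "p \<in> verts G' \<Longrightarrow> q \<in> verts G' \<Longrightarrow> {p, q} \<in> edges G \<longleftrightarrow> {p, q} \<in> edges G'"
  unfolding edges_G using part_disjoint by (auto simp: doubleton_eq_iff)

lemma co_edge_decompose: "{p, q} \<in> co_edges \<longleftrightarrow>
    {p, q} \<in> edges (complement G') \<or> (\<exists>S\<in>set Ss. p \<in> S \<and> q \<in> S \<and> p \<noteq> q)"
proof
  assume pq: "{p, q} \<in> co_edges"
  then have ne: "p \<noteq> q" "{p, q} \<notin> edges G" by (auto simp: co_edge_iff)
  consider "p \<in> verts G'" "q \<in> verts G'" | S where "p \<in> verts G'" "S \<in> set Ss" "q \<in> S"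
    | S where "q \<in> verts G'" "S \<in> set Ss" "p \<in> S"
    | S R where "S \<in> set Ss" "p \<in> S" "R \<in> set Ss" "q \<in> R"
    using pq by (auto simp: co_edge_iff verts_G)
  then show "{p, q} \<in> edges (complement G') \<or> (\<exists>S\<in>set Ss. p \<in> S \<and> q \<in> S \<and> p \<noteq> q)"
  proof cases
    case 1
    then show ?thesis using ne by (simp add: co_edge'_iff edge_in_G'_iff)
  next
    case 2
    then have "{p, q} \<in> edges G" unfolding edges_G by blast
    then show ?thesis using ne by simp
  next
    case 3
    then have "{q, p} \<in> edges G" unfolding edges_G by blast
    then show ?thesis using ne by (simp add: insert_commute)
  next
    case 4
    then have "S \<noteq> R \<Longrightarrow> {p, q} \<in> edges G" unfolding edges_G by blast
    then show ?thesis using ne 4 by blast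
  qed
next
  assume "{p, q} \<in> edges (complement G') \<or> (\<exists>S\<in>set Ss. p \<in> S \<and> q \<in> S \<and> p \<noteq> q)"
  then show "{p, q} \<in> co_edges"
  proof (elim disjE bexE conjE)
    assume "{p, q} \<in> edges (complement G')"
    then show ?thesis by (simp add: co_edge_iff co_edge'_iff edge_in_G'_iff verts_G)
  next
    fix S assume S: "S \<in> set Ss" "p \<in> S" "q \<in> S" "p \<noteq> q"
    have "{p, q} \<notin> edges G'" using S part_disjoint edge_in_verts' by blast
    moreover have "{p, q} \<noteq> {a, b}" if "a \<in> verts G'" for a b
      using that S part_disjoint by (auto simp: doubleton_eq_iff)
    moreover have "{p, q} \<noteq> {a, b}" if "A \<in> set Ss" "B \<in> set Ss" "A \<noteq> B" "a \<in> A" "b \<in> B" for a b A B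
      using that S parts_eq by (metis doubleton_eq_iff)
    ultimately have "{p, q} \<notin> edges G" unfolding edges_G by blast
    then show ?thesis using S by (auto simp: co_edge_iff verts_G)
  qed
qed

text \<open>Otherwise \<open>p\<close>, \<open>q\<close>, \<open>t\<close> would be a stable set of size 3 in \<open>G'\<close>.\<close>

lemma complement_triangle_free:
  assumes "{p, t} \<in> edges (complement G')" "{q, t} \<in> edges (complement G')" "p \<noteq> q"
  shows "{p, q} \<in> edges G"
proof (rule ccontr)
  assume "\<not> ?thesis"
  then have "{p, q} \<notin> edges G'" unfolding edges_G by blast
  then have "is_stable G' {p, q, t}"
    using assms simple' by (auto simp: is_stable_def co_edge'_iff insert_commute simple_graph_def)
  moreover have "finite {S. is_stable G' S}"
    using finite_verts(2) by (auto simp: is_stable_def intro: finite_subset[of _ "Pow (verts G')"])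
  ultimately have "card {p, q, t} \<le> stability_number G'"
    unfolding stability_number_def by (intro Max_ge) auto
  also have "\<dots> \<le> 2" using decomposition by (simp add: join_decomposition_def)
  finally show False using assms by (auto simp: co_edge'_iff)
qed

lemma tripleD:
  assumes "(u, v, w) \<in> T"
  shows "{u, v, w} \<in> set Ss" "(u, v) \<in> r" "(v, w) \<in> r" "(u, w) \<in> r"
    "u \<noteq> v" "v \<noteq> w" "u \<noteq> w"
proof -
  show *: "{u, v, w} \<in> set Ss" "(u, v) \<in> r" "(v, w) \<in> r"
    using assms by (auto simp: sorted_triples_def)
  then show "(u, w) \<in> r" using order_trans by blast
  then show "u \<noteq> v" "v \<noteq> w" "u \<noteq> w" using * order_irrefl by blast+
qed

lemma triple_co_edge:
  assumes "(u, v, w) \<in> T" "p \<in> {u, v, w}" "q \<in> {u, v, w}" "p \<noteq> q"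
  shows "{p, q} \<in> co_edges"
  unfolding co_edge_decompose using tripleD(1)[OF assms(1)] assms(2-4)
  by (intro disjI2 bexI[of _ "{u, v, w}"] conjI)

lemma sorted_triple_exists:
  assumes S: "S \<in> set Ss"
  obtains u v w where "S = {u, v, w}" "(u, v, w) \<in> T"
proof -
  obtain a b c where abc: "S = {a, b, c}" "a \<noteq> b" "b \<noteq> c" "a \<noteq> c"
    using card_part[OF S] by (auto simp: card_3_iff)
  then have V: "a \<in> verts G" "b \<in> verts G" "c \<in> verts G" using S verts_G by auto
  have perms: "{a, b, c} = {a, c, b}" "{a, b, c} = {b, a, c}" "{a, b, c} = {b, c, a}"
    "{a, b, c} = {c, a, b}" "{a, b, c} = {c, b, a}" by auto
  have "(a, b, c) \<in> T \<or> (a, c, b) \<in> T \<or> (b, a, c) \<in> T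
      \<or> (b, c, a) \<in> T \<or> (c, a, b) \<in> T \<or> (c, b, a) \<in> T"
    using order_total[OF V(1,2)] order_total[OF V(1,3)] order_total[OF V(2,3)] abc S
    by (auto simp: sorted_triples_def simp flip: perms)
  then show thesis using that abc(1) perms by metis
qed

lemma triple_unique:
  assumes t: "(u, v, w) \<in> T" "(u', v', w') \<in> T" and z: "z \<in> {u, v, w}" "z \<in> {u', v', w'}"
  shows "u' = u" "v' = v" "w' = w"
proof -
  have eq: "{u, v, w} = {u', v', w'}" using parts_eq tripleD(1) t z by meson
  note o = tripleD[OF t(1)] tripleD[OF t(2)] order_asym order_irrefl
  show u: "u' = u" using eq o by (metis insert_iff singletonD)
  show w: "w' = w" using eq o by (metis insert_iff singletonD)
  show "v' = v" using eq o u w by (metis insert_iff singletonD)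
qed

lemma triple_not_in_G':
  assumes "(u, v, w) \<in> T"
  shows "u \<notin> verts G'" "v \<notin> verts G'" "w \<notin> verts G'"
  using part_disjoint[OF tripleD(1)[OF assms]] by auto

lemma edges_H: "edges H = (`) Orig ` edges (complement G') \<union>
    (\<Union>(u, v, w)\<in>T. {{Prime u, Orig v}, {Orig v, Orig w}, {Orig w, DPrime u}})"
  by (simp add: H_graph_def)

lemma H_edge_cases:
  assumes "e \<in> edges H"
  obtains a where "a \<in> edges (complement G')" "e = Orig ` a"
  | u v w where "(u, v, w) \<in> T" "e \<in> {{Prime u, Orig v}, {Orig v, Orig w}, {Orig w, DPrime u}}"
proof -
  show thesis using assms[unfolded edges_H]
  proof (elim UnE imageE UN_E)
    fix a assume "e = Orig ` a" "a \<in> edges (complement G')"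
    then show thesis by (rule that(1)[rotated])
  next
    fix t assume t: "t \<in> T" "e \<in> (case t of (u, v, w) \<Rightarrow>
      {{Prime u, Orig v}, {Orig v, Orig w}, {Orig w, DPrime u}})"
    obtain u v w where "t = (u, v, w)" by (cases t)
    then show thesis using that(2)[of u v w] t by (simp only: prod.case)
  qed
qed

lemma path_edges_H:
  assumes "(u, v, w) \<in> T"
  shows "{Prime u, Orig v} \<in> edges H" "{Orig v, Orig w} \<in> edges H" "{Orig w, DPrime u} \<in> edges H"
  using assms unfolding edges_H by blast+

lemma finite_verts_H: "finite (verts H)"
proof -
  have "T \<subseteq> \<Union>(set Ss) \<times> \<Union>(set Ss) \<times> \<Union>(set Ss)" by (auto simp: sorted_triples_def)
  moreover have "finite (\<Union>(set Ss))" using finite_verts(1) verts_G by simp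
  ultimately have "finite T" by (meson finite_SigmaI finite_subset)
  then show ?thesis using finite_verts by (auto simp: H_graph_def)
qed

lemma edge_H:
  assumes "e \<in> edges H"
  shows "e \<subseteq> verts H" "card e = 2"
proof -
  show "e \<subseteq> verts H" using assms unfolding H_graph_def complement_def by fastforce
  show "card e = 2" using assms
  proof (cases rule: H_edge_cases)
    case (1 a)
    then show ?thesis by (simp add: complement_def card_image inj_on_def)
  next
    case (2 u v w)
    then show ?thesis using tripleD[OF 2(1)] by auto
  qed
qed

lemma finite_edges_H: "finite (edges H)"
  using finite_verts_H edge_H(1) by (meson Pow_iff finite_Pow_iff finite_subset subsetI)

lemma base_image_edge_H: "H_edge_to_co_edge ` edges H = co_edges"
proof (intro equalityI subsetI)
  fix a assume "a \<in> H_edge_to_co_edge ` edges H"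
  then obtain e where e: "e \<in> edges H" "a = H_edge_to_co_edge e" by blast
  show "a \<in> co_edges" using e(1)
  proof (cases rule: H_edge_cases)
    case (1 b)
    then obtain p q where "b = {p, q}" by (auto simp: complement_def card_2_iff)
    then show ?thesis using 1 e(2)
      by (simp only: H_edge_to_co_edge_simps co_edge_decompose simp_thms)
  next
    case (2 u v w)
    then have "a \<in> {{u, v}, {v, w}, {u, w}}" using e(2) by auto
    then show ?thesis using triple_co_edge[OF 2(1)] tripleD[OF 2(1)] by auto
  qed
next
  fix a assume a: "a \<in> co_edges"
  then obtain p q where pq: "a = {p, q}" by (auto simp: complement_def card_2_iff)
  consider "a \<in> edges (complement G')" | S where "S \<in> set Ss" "p \<in> S" "q \<in> S" "p \<noteq> q"
    using a[unfolded pq co_edge_decompose] pq by blast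
  then show "a \<in> H_edge_to_co_edge ` edges H"
  proof cases
    case 1
    then have "Orig ` a \<in> edges H" unfolding edges_H by blast
    then show ?thesis by (intro image_eqI[of _ _ "Orig ` a"]) simp_all
  next
    case 2
    then obtain u v w where uvw: "S = {u, v, w}" "(u, v, w) \<in> T" using sorted_triple_exists by metis
    then have "a \<in> {{u, v}, {v, w}, {u, w}}" using 2 pq by auto
    moreover have "{{u, v}, {v, w}, {u, w}} = H_edge_to_co_edge `
        {{Prime u, Orig v}, {Orig v, Orig w}, {Orig w, DPrime u}}" by simp
    ultimately show ?thesis using path_edges_H[OF uvw(2)] by blast
  qed
qed

lemma inj_on_base_edge_H: "inj_on H_edge_to_co_edge (edges H)"
proof (rule inj_onI)
  fix e f assume ef: "e \<in> edges H" "f \<in> edges H" and eq: "H_edge_to_co_edge e = H_edge_to_co_edge f"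
  have orig: "a \<subseteq> verts G' \<and> a \<noteq> {}" if "a \<in> edges (complement G')" for a
    using that by (auto simp: complement_def)
  have path: "H_edge_to_co_edge g \<subseteq> {u, v, w}" "H_edge_to_co_edge g \<noteq> {}"
    if "g \<in> {{Prime u, Orig v}, {Orig v, Orig w}, {Orig w, DPrime u}}" for g and u v w :: 'a
    using that by auto
  have mixed: False if "a \<in> edges (complement G')" "(u, v, w) \<in> T"
    "g \<in> {{Prime u, Orig v}, {Orig v, Orig w}, {Orig w, DPrime u}}" "H_edge_to_co_edge g = a"
    for a u v w g
    using orig[OF that(1)] path[OF that(3)] triple_not_in_G'[OF that(2)] that(4) by blast
  show "e = f" using ef(1)
  proof (cases rule: H_edge_cases)
    case e: (1 a)
    show ?thesis using ef(2)
    proof (cases rule: H_edge_cases)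
      case (1 b)
      then show ?thesis using e eq by simp
    next
      case (2 u v w)
      then show ?thesis using mixed[OF e(1) 2] e(2) eq by simp
    qed
  next
    case e: (2 u v w)
    show ?thesis using ef(2)
    proof (cases rule: H_edge_cases)
      case (1 b)
      then show ?thesis using mixed[OF 1(1) e] 1(2) eq by simp
    next
      case f: (2 u' v' w')
      obtain z where "z \<in> H_edge_to_co_edge e" using path[OF e(2)] by blast
      then have z: "z \<in> {u, v, w}" "z \<in> {u', v', w'}" using path(1)[OF e(2)] path(1)[OF f(2)] eq by auto
      have "u' = u" "v' = v" "w' = w" using triple_unique[OF e(1) f(1) z] by auto
      then show ?thesis using e(2) f(2) eq tripleD(5-7)[OF e(1)] by (auto simp: doubleton_eq_iff)
    qed
  qed
qed

section \<open>Conflicting variables are incident edges\<close>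

definition conflict :: "'a set \<Rightarrow> 'a set \<Rightarrow> bool" where
  "conflict a b \<longleftrightarrow> (\<exists>(u, K)\<in>rep_index r G.
     a \<in> rep_constraint_vars r G u K \<and> b \<in> rep_constraint_vars r G u K)"

text \<open>All variables of the constraint of \<open>t\<close> and \<open>K\<close> are edges at \<open>t\<close>. Two of them occur
  together for some choice of \<open>K\<close>, unless both other ends are later than \<open>t\<close> and not adjacent in
  \<open>G\<close>: then no clique contains both.\<close>

lemma conflict_iff:
  assumes "a \<noteq> b"
  shows "conflict a b \<longleftrightarrow> (\<exists>t p q. a = {t, p} \<and> b = {t, q} \<and> {t, p} \<in> co_edges \<and> {t, q} \<in> co_edges \<and>
    ((p, t) \<in> r \<or> (q, t) \<in> r \<or> {p, q} \<in> edges G))" (is "_ = ?R")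
proof
  assume "conflict a b"
  then obtain t K where K: "is_clique G K" "K \<subseteq> co_nbh_upper r G t"
    and ab: "a \<in> rep_constraint_vars r G t K" "b \<in> rep_constraint_vars r G t K"
    by (auto simp: conflict_def rep_index_def)
  have mem: "\<exists>p. c = {t, p} \<and> {t, p} \<in> co_edges \<and> ((p, t) \<in> r \<or> p \<in> K)"
    if c: "c \<in> rep_constraint_vars r G t K" for c
    using c K(2)
    by (auto simp: rep_constraint_vars_def co_nbh_lower_def co_nbh_upper_def insert_commute)
  obtain p q where p: "a = {t, p}" "{t, p} \<in> co_edges" "(p, t) \<in> r \<or> p \<in> K"
    and q: "b = {t, q}" "{t, q} \<in> co_edges" "(q, t) \<in> r \<or> q \<in> K"
    using mem[OF ab(1)] mem[OF ab(2)] by blast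
  have "p \<noteq> q" using p q assms by auto
  then have "(p, t) \<in> r \<or> (q, t) \<in> r \<or> {p, q} \<in> edges G"
    using K(1) p(3) q(3) unfolding is_clique_def by blast
  then show ?R using p q by blast
next
  assume ?R
  then obtain t p q where e: "a = {t, p}" "b = {t, q}" "{t, p} \<in> co_edges" "{t, q} \<in> co_edges"
    and or: "(p, t) \<in> r \<or> (q, t) \<in> r \<or> {p, q} \<in> edges G" by blast
  have V: "t \<in> verts G" "p \<in> verts G" "q \<in> verts G" "t \<noteq> p" "t \<noteq> q" using e
    by (auto simp: co_edge_iff)
  \<comment> \<open>The smallest clique whose constraint at \<open>t\<close> involves both edges; earlier neighbours appear in
    every constraint at \<open>t\<close>.\<close>
  define K where "K = {p, q} \<inter> co_nbh_upper r G t"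
  have "is_clique G K"
    unfolding is_clique_def
  proof (intro conjI ballI impI)
    show "K \<subseteq> verts G" using V by (auto simp: K_def)
    fix x y assume "x \<in> K" "y \<in> K" "x \<noteq> y"
    then have "{x, y} = {p, q}" "(t, p) \<in> r" "(t, q) \<in> r" by (auto simp: K_def co_nbh_upper_def)
    then show "{x, y} \<in> edges G" using or order_asym by metis
  qed
  then have "(t, K) \<in> rep_index r G" using V by (simp add: rep_index_def K_def)
  moreover have "{t, z} \<in> rep_constraint_vars r G t K" if "z \<in> {p, q}" for z
  proof (cases "(t, z) \<in> r")
    case True
    then have "z \<in> K" using that e V by (auto simp: K_def co_nbh_upper_def)
    then show ?thesis by (auto simp: rep_constraint_vars_def)
  next
    case False
    then have "z \<in> co_nbh_lower r G t" using that e V order_total[of t z]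
      by (auto simp: co_nbh_lower_def)
    then show ?thesis unfolding rep_constraint_vars_def by (auto simp: insert_commute)
  qed
  ultimately show "conflict a b" unfolding conflict_def e by blast
qed

lemma conflict_commute: "conflict a b \<longleftrightarrow> conflict b a"
  by (auto simp: conflict_def)

lemma path_conflict:
  assumes "(u, v, w) \<in> T"
  shows "conflict {u, v} {v, w}" "conflict {v, w} {u, w}"
proof -
  note t = tripleD[OF assms]
  have co: "{v, u} \<in> co_edges" "{v, w} \<in> co_edges" "{w, v} \<in> co_edges" "{w, u} \<in> co_edges"
    by (rule triple_co_edge[OF assms]; use t in simp)+
  have ne: "{u, v} \<noteq> {v, w}" "{v, w} \<noteq> {u, w}" using t by (auto simp: doubleton_eq_iff)
  show "conflict {u, v} {v, w}"
    unfolding conflict_iff[OF ne(1)] using co t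
    by (intro exI[of _ v] exI[of _ u] exI[of _ w]) (simp add: insert_commute)
  show "conflict {v, w} {u, w}"
    unfolding conflict_iff[OF ne(2)] using co t
    by (intro exI[of _ w] exI[of _ v] exI[of _ u]) (simp add: insert_commute)
qed

text \<open>Erasing the marks sends the edges of the complement of \<open>G'\<close> and the paths of distinct triples
  to disjoint vertex sets, so edges of \<open>H\<close> that meet belong to the same part. In the first part the
  other two ends are adjacent in \<open>G\<close>, by triangle-freeness; on a path only \<open>u'v\<close>, \<open>vw\<close> and \<open>vw\<close>,
  \<open>wu''\<close> meet.\<close>

lemma meet_imp_conflict:
  assumes ef: "e \<in> edges H" "f \<in> edges H" "e \<noteq> f" "e \<inter> f \<noteq> {}"
  shows "conflict (H_edge_to_co_edge e) (H_edge_to_co_edge f)"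
proof -
  obtain z where z: "z \<in> e" "z \<in> f" using ef by blast
  have path: "base x \<in> {u, v, w}"
    if "x \<in> g" "g \<in> {{Prime u, Orig v}, {Orig v, Orig w}, {Orig w, DPrime u}}"
    for x g and u v w :: 'a
    using that by auto
  have orig: "base x \<in> verts G'" if "x \<in> Orig ` a" "a \<in> edges (complement G')" for x a
    using that by (auto simp: complement_def)
  show ?thesis using ef(1)
  proof (cases rule: H_edge_cases)
    case e: (1 a)
    show ?thesis using ef(2)
    proof (cases rule: H_edge_cases)
      case f: (1 b)
      obtain t where t: "t \<in> a" "t \<in> b" using z e f by auto
      have co: "a \<in> co_edges" "b \<in> co_edges"
        using ef(1,2) e(2) f(2) base_image_edge_H by (metis H_edge_to_co_edge_simps(1) imageI)+
      obtain p q where pq: "a = {t, p}" "b = {t, q}" using co_edge_doubleton co t by metis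
      have "a \<noteq> b" using ef(3) e f by auto
      then have "{p, q} \<in> edges G"
        using e(1) f(1) pq by (intro complement_triangle_free[of p t q]) (auto simp: insert_commute)
      then have "conflict a b" unfolding conflict_iff[OF \<open>a \<noteq> b\<close>] using co pq by blast
      then show ?thesis using e f by simp
    next
      case f: (2 u v w)
      have "base z \<in> verts G'" "base z \<in> {u, v, w}" using orig path e f z by metis+
      then show ?thesis using triple_not_in_G'[OF f(1)] by auto
    qed
  next
    case e: (2 u v w)
    show ?thesis using ef(2)
    proof (cases rule: H_edge_cases)
      case f: (1 b)
      have "base z \<in> verts G'" "base z \<in> {u, v, w}" using orig path e f z by metis+
      then show ?thesis using triple_not_in_G'[OF e(1)] by auto
    next
      case f: (2 u' v' w')
      have "base z \<in> {u, v, w}" "base z \<in> {u', v', w'}" using path e f z by metis+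
      then have "u' = u" "v' = v" "w' = w" using triple_unique[OF e(1) f(1)] by auto
      then have f': "f \<in> {{Prime u, Orig v}, {Orig v, Orig w}, {Orig w, DPrime u}}" using f by simp
      note pc = path_conflict[OF e(1)] path_conflict[OF e(1), THEN conflict_commute[THEN iffD1]]
      show ?thesis using e(2) f' ef(3,4)
        by (elim insertE emptyE) (use tripleD(5-7)[OF e(1)] in \<open>simp_all add: pc\<close>)
    qed
  qed
qed

text \<open>Within a triple \<open>u \<prec> v \<prec> w\<close> the common endpoint \<open>t\<close> of two conflicting edges is not \<open>u\<close>,
  and the other two vertices are not split.\<close>

lemma conflict_imp_meet:
  assumes ef: "e \<in> edges H" "f \<in> edges H" "e \<noteq> f"
    and c: "conflict (H_edge_to_co_edge e) (H_edge_to_co_edge f)"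
  shows "e \<inter> f \<noteq> {}"
proof -
  have lift: "e = g" if "e \<in> edges H" "g \<in> edges H" "H_edge_to_co_edge e = H_edge_to_co_edge g"
    for e g
    using inj_on_base_edge_H that by (auto dest: inj_onD)
  have ne: "H_edge_to_co_edge e \<noteq> H_edge_to_co_edge f" using ef lift by blast
  obtain t p q where h: "H_edge_to_co_edge e = {t, p}" "H_edge_to_co_edge f = {t, q}"
    and co: "{t, p} \<in> co_edges" "{t, q} \<in> co_edges"
    and or: "(p, t) \<in> r \<or> (q, t) \<in> r \<or> {p, q} \<in> edges G"
    using c unfolding conflict_iff[OF ne] by blast
  have pq: "p \<noteq> q" "t \<noteq> p" "t \<noteq> q" using ne h co by (auto simp: co_edge_iff)
  show ?thesis
  proof (cases "t \<in> verts G'")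
    case True
    have "\<not> (\<exists>S\<in>set Ss. t \<in> S)" using True part_disjoint by blast
    then have "{t, p} \<in> edges (complement G')" "{t, q} \<in> edges (complement G')"
      using co[unfolded co_edge_decompose] by blast+
    then have "Orig ` {t, p} \<in> edges H" "Orig ` {t, q} \<in> edges H" unfolding edges_H by blast+
    then have "e = Orig ` {t, p}" "f = Orig ` {t, q}"
      using lift ef(1,2) h H_edge_to_co_edge_simps(1) by metis+
    then show ?thesis by auto
  next
    case False
    then have "{t, p} \<notin> edges (complement G')" "{t, q} \<notin> edges (complement G')"
      by (auto simp: co_edge'_iff)
    then obtain S R where "S \<in> set Ss" "t \<in> S" "p \<in> S" "R \<in> set Ss" "t \<in> R" "q \<in> R"
      using co[unfolded co_edge_decompose] by blast
    then have S: "S \<in> set Ss" "t \<in> S" "p \<in> S" "q \<in> S" using parts_eq by blast+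
    obtain u v w where uvw: "S = {u, v, w}" "(u, v, w) \<in> T" by (rule sorted_triple_exists[OF S(1)])
    note tr = tripleD[OF uvw(2)]
    have "t \<noteq> u"
    proof
      assume "t = u"
      then have "{p, q} = {v, w}" using S pq uvw(1) by auto
      moreover have "{v, w} \<in> co_edges" using triple_co_edge[OF uvw(2)] tr by simp
      ultimately have "{p, q} \<notin> edges G" by (metis co_edge_iff)
      moreover have "(t, p) \<in> r" "(t, q) \<in> r" using \<open>t = u\<close> \<open>{p, q} = {v, w}\<close> tr
        by (auto simp: doubleton_eq_iff)
      ultimately show False using or order_asym by blast
    qed
    then have "t = v \<and> {{t, p}, {t, q}} = {{u, v}, {v, w}}
      \<or> t = w \<and> {{t, p}, {t, q}} = {{v, w}, {u, w}}"
      using S pq uvw(1) by (auto simp: insert_commute)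
    then consider "{t, p} = {u, v}" "{t, q} = {v, w}" | "{t, p} = {v, w}" "{t, q} = {u, v}"
      | "{t, p} = {v, w}" "{t, q} = {u, w}" | "{t, p} = {u, w}" "{t, q} = {v, w}"
      by (auto simp: doubleton_eq_iff)
    moreover have "g = {Prime u, Orig v}" if "g \<in> edges H" "H_edge_to_co_edge g = {u, v}" for g
      using lift[OF that(1) path_edges_H(1)[OF uvw(2)]] that(2) by simp
    moreover have "g = {Orig v, Orig w}" if "g \<in> edges H" "H_edge_to_co_edge g = {v, w}" for g
      using lift[OF that(1) path_edges_H(2)[OF uvw(2)]] that(2) by simp
    moreover have "g = {Orig w, DPrime u}" if "g \<in> edges H" "H_edge_to_co_edge g = {u, w}" for g
      using lift[OF that(1) path_edges_H(3)[OF uvw(2)]] that(2) by simp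
    ultimately have "e = {Prime u, Orig v} \<and> f = {Orig v, Orig w}
      \<or> e = {Orig v, Orig w} \<and> f = {Prime u, Orig v} \<or>
      e = {Orig v, Orig w} \<and> f = {Orig w, DPrime u} \<or> e = {Orig w, DPrime u} \<and> f = {Orig v, Orig w}"
      using ef(1,2) h by metis
    then show ?thesis by auto
  qed
qed

lemma graph_iso_rep_graph: "graph_iso H_edge_to_co_edge (line_graph H) (rep_graph r G)"
  unfolding graph_iso_def
proof (intro conjI ballI)
  show "bij_betw H_edge_to_co_edge (verts (line_graph H)) (verts (rep_graph r G))"
    using inj_on_base_edge_H base_image_edge_H
    by (simp add: bij_betw_def line_graph_def rep_graph_def)
  fix e f assume "e \<in> verts (line_graph H)" "f \<in> verts (line_graph H)"
  then have ef: "e \<in> edges H" "f \<in> edges H" by (simp_all add: line_graph_def)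
  let ?h = H_edge_to_co_edge
  have "{e, f} \<in> edges (line_graph H) \<longleftrightarrow> e \<noteq> f \<and> e \<inter> f \<noteq> {}"
    using ef by (auto simp: line_graph_def doubleton_eq_iff)
  also have "\<dots> \<longleftrightarrow> ?h e \<noteq> ?h f \<and> conflict (?h e) (?h f)"
    using meet_imp_conflict[OF ef] conflict_imp_meet[OF ef] inj_on_base_edge_H ef
    by (auto dest: inj_onD)
  also have "\<dots> \<longleftrightarrow> {?h e, ?h f} \<in> edges (rep_graph r G)"
  proof
    assume "?h e \<noteq> ?h f \<and> conflict (?h e) (?h f)"
    then show "{?h e, ?h f} \<in> edges (rep_graph r G)"
      using ef base_image_edge_H by (simp add: rep_graph_def flip: conflict_def) blast
  next
    assume "{?h e, ?h f} \<in> edges (rep_graph r G)"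
    then obtain a b where "{?h e, ?h f} = {a, b}" "a \<noteq> b" "conflict a b"
      by (auto simp: rep_graph_def conflict_def)
    then show "?h e \<noteq> ?h f \<and> conflict (?h e) (?h f)"
      using conflict_commute by (auto simp: doubleton_eq_iff)
  qed
  finally show "{e, f} \<in> edges (line_graph H) \<longleftrightarrow> {?h e, ?h f} \<in> edges (rep_graph r G)" .
qed

section \<open>The representatives polytope is a matching polytope\<close>

text \<open>The two sums of a representatives constraint run over distinct coordinates, because earlier
  and later neighbours are different vertices.\<close>

lemma rep_constraint_iff_sum:
  assumes uK: "(u, K) \<in> rep_index r G"
  shows "finite (rep_constraint_vars r G u K)" "rep_constraint_vars r G u K \<subseteq> co_edges"
    "rep_constraint r G u K x \<longleftrightarrow> sum (Poly_Mapping.lookup x) (rep_constraint_vars r G u K) \<le> 1"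
proof -
  let ?L = "co_nbh_lower r G u" and ?l = "Poly_Mapping.lookup x"
  have K: "K \<subseteq> co_nbh_upper r G u" using uK by (auto simp: rep_index_def)
  have vars: "rep_constraint_vars r G u K = (\<lambda>v. {v, u}) ` ?L \<union> (\<lambda>v. {u, v}) ` K"
    by (auto simp: rep_constraint_vars_def)
  have fin: "finite ?L" "finite K"
    using finite_verts(1) K by (auto simp: co_nbh_lower_def co_nbh_upper_def intro: finite_subset)
  then show "finite (rep_constraint_vars r G u K)" by (simp add: vars)
  show "rep_constraint_vars r G u K \<subseteq> co_edges"
    using K by (auto simp: vars co_nbh_lower_def co_nbh_upper_def insert_commute)
  have "(v, u) \<in> r" if "v \<in> ?L" for v using that by (simp add: co_nbh_lower_def)
  moreover have "(u, v) \<in> r" if "v \<in> K" for v using that K by (auto simp: co_nbh_upper_def)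
  ultimately have "?L \<inter> K = {}" using order_asym by blast
  then have disj: "(\<lambda>v. {v, u}) ` ?L \<inter> (\<lambda>v. {u, v}) ` K = {}" by (auto simp: doubleton_eq_iff)
  have inj: "inj_on (\<lambda>v. {v, u}) ?L" "inj_on (\<lambda>v. {u, v}) K"
    by (auto simp: inj_on_def doubleton_eq_iff)
  have "sum ?l (rep_constraint_vars r G u K) = (\<Sum>v\<in>?L. ?l {v, u}) + (\<Sum>v\<in>K. ?l {u, v})"
    unfolding vars using fin disj inj by (simp add: sum.union_disjoint sum.reindex)
  then show "rep_constraint r G u K x \<longleftrightarrow> sum ?l (rep_constraint_vars r G u K) \<le> 1"
    by (simp add: rep_constraint_def)
qed

text \<open>On a 0/1 vector each constraint allows at most one of its variables to be 1, so together the
  constraints say that no two variables of value 1 conflict.\<close>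

lemma rep_constraints_iff_matching:
  assumes x01: "\<forall>a\<in>co_edges. Poly_Mapping.lookup x a \<in> {0, 1}"
  shows "(\<forall>(u, K)\<in>rep_index r G. rep_constraint r G u K x) \<longleftrightarrow>
    matching (edges H) {e \<in> edges H. Poly_Mapping.lookup x (H_edge_to_co_edge e) = 1}"
    (is "?constraints \<longleftrightarrow> matching _ ?M")
proof -
  let ?l = "Poly_Mapping.lookup x" and ?h = H_edge_to_co_edge
  have single: "rep_constraint r G u K x \<longleftrightarrow>
      (\<forall>a\<in>rep_constraint_vars r G u K. \<forall>b\<in>rep_constraint_vars r G u K. ?l a = 1 \<longrightarrow> ?l b = 1 \<longrightarrow> a = b)"
    if uK: "(u, K) \<in> rep_index r G" for u K
    unfolding rep_constraint_iff_sum(3)[OF uK]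
    by (rule sum_01_le_1_iff) (use rep_constraint_iff_sum(1,2)[OF uK] x01 in auto)
  have conflict: "conflict a b \<longleftrightarrow> (\<exists>u K. (u, K) \<in> rep_index r G \<and>
      a \<in> rep_constraint_vars r G u K \<and> b \<in> rep_constraint_vars r G u K)" for a b
    by (auto simp: conflict_def)
  have in_co: "a \<in> co_edges" "b \<in> co_edges" if "conflict a b" for a b
    using that[unfolded conflict] rep_constraint_iff_sum(2) by (meson subsetD)+
  have "?constraints \<longleftrightarrow> (\<forall>u K. (u, K) \<in> rep_index r G \<longrightarrow> rep_constraint r G u K x)" by auto
  also have "\<dots> \<longleftrightarrow> (\<forall>a b. conflict a b \<longrightarrow> ?l a = 1 \<longrightarrow> ?l b = 1 \<longrightarrow> a = b)"
    unfolding conflict using single by (simp only: Ball_def) meson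
  also have "\<dots> \<longleftrightarrow> (\<forall>e\<in>edges H. \<forall>f\<in>edges H. conflict (?h e) (?h f) \<longrightarrow>
      ?l (?h e) = 1 \<longrightarrow> ?l (?h f) = 1 \<longrightarrow> ?h e = ?h f)"
  proof (intro iffI ballI allI impI)
    fix a b assume *: "\<forall>e\<in>edges H. \<forall>f\<in>edges H. conflict (?h e) (?h f) \<longrightarrow>
      ?l (?h e) = 1 \<longrightarrow> ?l (?h f) = 1 \<longrightarrow> ?h e = ?h f" and ab: "conflict a b" "?l a = 1" "?l b = 1"
    obtain e f where "e \<in> edges H" "f \<in> edges H" "a = ?h e" "b = ?h f"
      using in_co[OF ab(1)] base_image_edge_H by (metis imageE)
    then show "a = b" using * ab by blast
  qed blast
  also have "\<dots> \<longleftrightarrow> (\<forall>e\<in>?M. \<forall>f\<in>?M. e \<noteq> f \<longrightarrow> e \<inter> f = {})"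
  proof -
    have key: "(conflict (?h e) (?h f) \<longrightarrow> ?h e = ?h f) \<longleftrightarrow> (e \<noteq> f \<longrightarrow> e \<inter> f = {})"
      if "e \<in> edges H" "f \<in> edges H" for e f
      using meet_imp_conflict[OF that] conflict_imp_meet[OF that]
        inj_onD[OF inj_on_base_edge_H _ that]
      by (cases "e = f") auto
    have "(conflict (?h e) (?h f) \<longrightarrow> ?l (?h e) = 1 \<longrightarrow> ?l (?h f) = 1 \<longrightarrow> ?h e = ?h f) \<longleftrightarrow>
        (?l (?h e) = 1 \<longrightarrow> ?l (?h f) = 1 \<longrightarrow> e \<noteq> f \<longrightarrow> e \<inter> f = {})"
      if "e \<in> edges H" "f \<in> edges H" for e f
      using key[OF that] by argo
    then show ?thesis by (simp only: Ball_def mem_Collect_eq) meson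
  qed
  also have "\<dots> \<longleftrightarrow> matching (edges H) ?M" by (auto simp: matching_def disjoint_def)
  finally show ?thesis .
qed

lemma sum_neighbourhood_H:
  "(\<Sum>v\<in>neighbourhood H u. g {u, v}) = (\<Sum>e | e \<in> edges H \<and> u \<in> e. g e)" for g :: "_ \<Rightarrow> real"
proof -
  have inj: "inj_on (\<lambda>v. {u, v}) (neighbourhood H u)" by (auto simp: inj_on_def doubleton_eq_iff)
  have "(\<lambda>v. {u, v}) ` neighbourhood H u = {e \<in> edges H. u \<in> e}"
  proof (intro equalityI subsetI)
    fix e assume "e \<in> {e \<in> edges H. u \<in> e}"
    then have e: "e \<in> edges H" "u \<in> e" by auto
    then obtain v where "e = {u, v}" using edge_H(2)[OF e(1)]
      by (auto simp: card_2_iff insert_commute)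
    then show "e \<in> (\<lambda>v. {u, v}) ` neighbourhood H u"
      using e edge_H(1)[OF e(1)] by (auto simp: neighbourhood_def)
  qed (auto simp: neighbourhood_def)
  then show ?thesis using sum.reindex[OF inj, of g] by simp
qed

lemma rep_polytope_eq: "rep_polytope r G = {x \<in> co_edge_vectors G.
    edmonds_inequalities (verts H) (edges H) (\<lambda>e. Poly_Mapping.lookup x (H_edge_to_co_edge e))}"
proof -
  have "{x \<in> co_edge_vectors G. (\<forall>e\<in>co_edges. Poly_Mapping.lookup x e \<in> {0, 1}) \<and>
        (\<forall>(u, K)\<in>rep_index r G. rep_constraint r G u K x)} =
    {x. Poly_Mapping.keys x \<subseteq> H_edge_to_co_edge ` edges H \<and>
      (\<forall>i\<in>H_edge_to_co_edge ` edges H. Poly_Mapping.lookup x i \<in> {0, 1}) \<and>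
      matching (edges H) {e \<in> edges H. Poly_Mapping.lookup x (H_edge_to_co_edge e) = 1}}"
    unfolding base_image_edge_H co_edge_vectors_def
    using rep_constraints_iff_matching by blast
  then show ?thesis
    using edmonds_matching_polytope[OF finite_edges_H _ inj_on_base_edge_H, of "verts H"] edge_H
    by (simp add: rep_polytope_def co_edge_vectors_def base_image_edge_H)
qed

end

theorem corollary3p11:
  fixes G G' :: "'a graph" and Ss :: "'a set list"
    and r :: "('a \<times> 'a) set" and H :: "'a hvertex graph"
  assumes "simple_graph G"
    and "co_K4_diamond_paw_free G"
    and "strict_linear_order_on (verts G) r"
    and "join_decomposition G G' Ss"
    and "H = H_graph r G' Ss"
  shows "graph_iso H_edge_to_co_edge (line_graph H) (rep_graph r G) \<and>
    rep_polytope r G =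
      {x \<in> co_edge_vectors G.
         (\<forall>u\<in>verts H.
            (\<Sum>v\<in>neighbourhood H u. Poly_Mapping.lookup x (H_edge_to_co_edge {u, v})) \<le> 1) \<and>
         (\<forall>S. S \<subseteq> verts H \<and> odd (card S) \<longrightarrow>
            (\<Sum>e\<in>edges_within H S. Poly_Mapping.lookup x (H_edge_to_co_edge e))
              \<le> (real (card S) - 1) / 2) \<and>
         (\<forall>e\<in>edges H. 0 \<le> Poly_Mapping.lookup x (H_edge_to_co_edge e))}"
proof -
  interpret join_decomposed_graph G G' Ss r
    using assms by unfold_locales
  show ?thesis
    unfolding assms(5) rep_polytope_eq edmonds_inequalities_def edges_within_def
    using graph_iso_rep_graph
      sum_neighbourhood_H[of "\<lambda>e. Poly_Mapping.lookup _ (H_edge_to_co_edge e)"] by simp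
qed

end
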